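(* Let $A$ be an annihilator $\sigma$-$C^{\ast}$-algebra. Then $A$ is topologically ${}^{\ast}$-isomorphic to the Cartesian product (with product topology) of a countable family of annihilator $C^{\ast}$-algebras.
   Context: A locally $C^{\ast}$-algebra is a complete Hausdorff locally convex ${}^{\ast}$-algebra over $\mathbb{C}$ with jointly continuous multiplication whose topology is given by a family of $C^{\ast}$-seminorms; a $\sigma$-$C^{\ast}$-algebra is a metrizable locally $C^{\ast}$-algebra. A topological algebra $A$ is an annihilator algebra if for every closed left ideal $J$ and closed right ideal $K$: $\mathrm{ran}(J)=0\iff J=A$ and $\mathrm{lan}(K)=0\iff K=A$, where $\mathrm{lan}(S)=\{a:aS=0\}$, $\mathrm{ran}(S)=\{a:Sa=0\}$. *)

theory Defs
  imports "HOL-Analysis.Analysis"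
begin

record 'a lcstar =
  lc_carrier :: "'a set"
  lc_add :: "'a \<Rightarrow> 'a \<Rightarrow> 'a"
  lc_mult :: "'a \<Rightarrow> 'a \<Rightarrow> 'a"
  lc_smult :: "complex \<Rightarrow> 'a \<Rightarrow> 'a"
  lc_star :: "'a \<Rightarrow> 'a"
  lc_zero :: "'a"
  lc_seminorms :: "('a \<Rightarrow> real) set"

definition lc_sub :: "'a lcstar \<Rightarrow> 'a \<Rightarrow> 'a \<Rightarrow> 'a" where
  "lc_sub A x y = lc_add A x (lc_smult A (-1) y)"

definition star_algebra :: "'a lcstar \<Rightarrow> bool" where
  "star_algebra A \<longleftrightarrow>
    (let C = lc_carrier A; add = lc_add A; mult = lc_mult A; sm = lc_smult A;
         st = lc_star A; z = lc_zero A in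
     z \<in> C \<and>
     (\<forall>x\<in>C. \<forall>y\<in>C. add x y \<in> C \<and> mult x y \<in> C) \<and>
     (\<forall>c. \<forall>x\<in>C. sm c x \<in> C) \<and> (\<forall>x\<in>C. st x \<in> C) \<and>
     (\<forall>x\<in>C. \<forall>y\<in>C. \<forall>w\<in>C. add (add x y) w = add x (add y w)) \<and>
     (\<forall>x\<in>C. \<forall>y\<in>C. add x y = add y x) \<and>
     (\<forall>x\<in>C. add z x = x) \<and>
     (\<forall>x\<in>C. add x (sm (-1) x) = z) \<and>
     (\<forall>c. \<forall>x\<in>C. \<forall>y\<in>C. sm c (add x y) = add (sm c x) (sm c y)) \<and>
     (\<forall>c d. \<forall>x\<in>C. sm (c + d) x = add (sm c x) (sm d x)) \<and>
     (\<forall>c d. \<forall>x\<in>C. sm c (sm d x) = sm (c * d) x) \<and>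
     (\<forall>x\<in>C. sm 1 x = x) \<and>
     (\<forall>x\<in>C. \<forall>y\<in>C. \<forall>w\<in>C. mult (mult x y) w = mult x (mult y w)) \<and>
     (\<forall>x\<in>C. \<forall>y\<in>C. \<forall>w\<in>C. mult x (add y w) = add (mult x y) (mult x w)) \<and>
     (\<forall>x\<in>C. \<forall>y\<in>C. \<forall>w\<in>C. mult (add x y) w = add (mult x w) (mult y w)) \<and>
     (\<forall>c. \<forall>x\<in>C. \<forall>y\<in>C. mult (sm c x) y = sm c (mult x y) \<and> mult x (sm c y) = sm c (mult x y)) \<and>
     (\<forall>x\<in>C. \<forall>y\<in>C. st (add x y) = add (st x) (st y)) \<and>
     (\<forall>c. \<forall>x\<in>C. st (sm c x) = sm (cnj c) (st x)) \<and>
     (\<forall>x\<in>C. st (st x) = x) \<and>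
     (\<forall>x\<in>C. \<forall>y\<in>C. st (mult x y) = mult (st y) (st x)))"

definition c_star_seminorm :: "'a lcstar \<Rightarrow> ('a \<Rightarrow> real) \<Rightarrow> bool" where
  "c_star_seminorm A p \<longleftrightarrow>
    (\<forall>x\<in>lc_carrier A. 0 \<le> p x) \<and>
    (\<forall>x\<in>lc_carrier A. \<forall>y\<in>lc_carrier A. p (lc_add A x y) \<le> p x + p y) \<and>
    (\<forall>c. \<forall>x\<in>lc_carrier A. p (lc_smult A c x) = cmod c * p x) \<and>
    (\<forall>x\<in>lc_carrier A. \<forall>y\<in>lc_carrier A. p (lc_mult A x y) \<le> p x * p y) \<and>
    (\<forall>x\<in>lc_carrier A. p (lc_mult A (lc_star A x) x) = (p x)\<^sup>2)"

definition lc_topology :: "'a lcstar \<Rightarrow> 'a topology" where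
  "lc_topology A = topology (\<lambda>U. U \<subseteq> lc_carrier A \<and>
     (\<forall>x\<in>U. \<exists>F e. finite F \<and> F \<subseteq> lc_seminorms A \<and> 0 < e \<and>
        {y \<in> lc_carrier A. \<forall>p\<in>F. p (lc_sub A y x) < e} \<subseteq> U))"

definition lc_complete :: "'a lcstar \<Rightarrow> bool" where
  "lc_complete A \<longleftrightarrow>
    (\<forall>F. F \<noteq> bot \<and> eventually (\<lambda>x. x \<in> lc_carrier A) F \<and>
         (\<forall>p\<in>lc_seminorms A. \<forall>e>0. eventually (\<lambda>(x, y). p (lc_sub A x y) < e) (F \<times>\<^sub>F F))
      \<longrightarrow> (\<exists>a\<in>lc_carrier A. \<forall>p\<in>lc_seminorms A. \<forall>e>0.
             eventually (\<lambda>x. p (lc_sub A x a) < e) F))"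

definition locally_c_star_algebra :: "'a lcstar \<Rightarrow> bool" where
  "locally_c_star_algebra A \<longleftrightarrow>
    star_algebra A \<and>
    (\<forall>p\<in>lc_seminorms A. c_star_seminorm A p) \<and>
    (\<forall>x\<in>lc_carrier A. x \<noteq> lc_zero A \<longrightarrow> (\<exists>p\<in>lc_seminorms A. p x \<noteq> 0)) \<and>
    continuous_map (prod_topology (lc_topology A) (lc_topology A)) (lc_topology A)
       (\<lambda>(x, y). lc_mult A x y) \<and>
    lc_complete A"

definition sigma_c_star_algebra :: "'a lcstar \<Rightarrow> bool" where
  "sigma_c_star_algebra A \<longleftrightarrow> locally_c_star_algebra A \<and> metrizable_space (lc_topology A)"

definition c_star_algebra :: "'a lcstar \<Rightarrow> bool" where
  "c_star_algebra A \<longleftrightarrow> locally_c_star_algebra A \<and> (\<exists>n. lc_seminorms A = {n})"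

definition lc_subspace :: "'a lcstar \<Rightarrow> 'a set \<Rightarrow> bool" where
  "lc_subspace A S \<longleftrightarrow> S \<subseteq> lc_carrier A \<and> lc_zero A \<in> S \<and>
     (\<forall>x\<in>S. \<forall>y\<in>S. lc_add A x y \<in> S) \<and> (\<forall>c. \<forall>x\<in>S. lc_smult A c x \<in> S)"

definition closed_left_ideal :: "'a lcstar \<Rightarrow> 'a set \<Rightarrow> bool" where
  "closed_left_ideal A J \<longleftrightarrow> lc_subspace A J \<and>
     (\<forall>a\<in>lc_carrier A. \<forall>x\<in>J. lc_mult A a x \<in> J) \<and> closedin (lc_topology A) J"

definition closed_right_ideal :: "'a lcstar \<Rightarrow> 'a set \<Rightarrow> bool" where
  "closed_right_ideal A K \<longleftrightarrow> lc_subspace A K \<and>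
     (\<forall>a\<in>lc_carrier A. \<forall>x\<in>K. lc_mult A x a \<in> K) \<and> closedin (lc_topology A) K"

definition lan :: "'a lcstar \<Rightarrow> 'a set \<Rightarrow> 'a set" where
  "lan A S = {a \<in> lc_carrier A. \<forall>s\<in>S. lc_mult A a s = lc_zero A}"

definition ran :: "'a lcstar \<Rightarrow> 'a set \<Rightarrow> 'a set" where
  "ran A S = {a \<in> lc_carrier A. \<forall>s\<in>S. lc_mult A s a = lc_zero A}"

definition annihilator_algebra :: "'a lcstar \<Rightarrow> bool" where
  "annihilator_algebra A \<longleftrightarrow>
    (\<forall>J. closed_left_ideal A J \<longrightarrow> (ran A J = {lc_zero A} \<longleftrightarrow> J = lc_carrier A)) \<and>
    (\<forall>K. closed_right_ideal A K \<longrightarrow> (lan A K = {lc_zero A} \<longleftrightarrow> K = lc_carrier A))"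

definition top_star_iso_product ::
  "'a lcstar \<Rightarrow> 'i set \<Rightarrow> ('i \<Rightarrow> 'b lcstar) \<Rightarrow> ('a \<Rightarrow> 'i \<Rightarrow> 'b) \<Rightarrow> bool" where
  "top_star_iso_product A I B f \<longleftrightarrow>
    homeomorphic_map (lc_topology A) (product_topology (\<lambda>i. lc_topology (B i)) I) f \<and>
    f ` lc_carrier A = (\<Pi>\<^sub>E i\<in>I. lc_carrier (B i)) \<and>
    inj_on f (lc_carrier A) \<and>
    (\<forall>x\<in>lc_carrier A. \<forall>y\<in>lc_carrier A.
        f (lc_add A x y) = (\<lambda>i\<in>I. lc_add (B i) (f x i) (f y i)) \<and>
        f (lc_mult A x y) = (\<lambda>i\<in>I. lc_mult (B i) (f x i) (f y i))) \<and>
    (\<forall>c. \<forall>x\<in>lc_carrier A. f (lc_smult A c x) = (\<lambda>i\<in>I. lc_smult (B i) c (f x i))) \<and>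
    (\<forall>x\<in>lc_carrier A. f (lc_star A x) = (\<lambda>i\<in>I. lc_star (B i) (f x i)))"

end

theory Submission
  imports Defs "HOL-Computational_Algebra.Polynomial"
begin

text \<open>
  Metrizability yields an increasing sequence \<open>q n\<close> of \<open>C*\<close>-seminorms, \<open>q 0 = 0\<close>, defining the
  topology. If \<open>I\<close> is a closed selfadjoint ideal and \<open>I\<^sup>\<bottom>\<close> its two-sided annihilator, the annihilator
  condition makes \<open>I + I\<^sup>\<bottom>\<close> dense. For \<open>a \<in> I\<close>, \<open>b \<in> I\<^sup>\<bottom>\<close> the \<open>C*\<close>-identity gives \<open>q n a \<le> q n (a + b)\<close>,
  so by completeness \<open>A = I \<oplus> I\<^sup>\<bottom>\<close>. On the complement of the kernel of \<open>q n\<close> the norm \<open>q n\<close> dominates all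
  other seminorms. Hence the ideals \<open>ker q n \<inter> (ker q (n + 1))\<^sup>\<bottom>\<close> are \<open>C*\<close>-algebras under \<open>q (n + 1)\<close>;
  they are mutually orthogonal, and \<open>A\<close> is their product.
\<close>

subsection \<open>Algebraic identities\<close>

text \<open>The pivot is that \<open>q n\<close> dominates all seminorms on the complement of its
  kernel. There is no unit and no completeness for a single seminorm to start from, so spectra in a
  quotient are replaced by an elementary statement about one seminorm: if \<open>y\<close> is
  selfadjoint and \<open>q m y = 1\<close>, then for some \<open>c\<close> on the unit circle no
  \<open>(1 + b) (1 - c y)\<close> comes within distance 1/2 of 1. If moreover
  \<open>q n y < 1\<close>, the annihilator condition turns this failure into a nonzero element
  fixed by \<open>c y\<close>, which \<open>q n\<close> has to kill.

  Density of the sum of an ideal and its complement rests on definiteness: an element annihilated by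
  both parts is annihilated by its own adjoint, hence zero.

  The full product appears, and not a smaller sum, because \<open>q k\<close> sees only the first
  \<open>k\<close> blocks: any choice of components has partial sums that become constant for each
  seminorm. The start \<open>q 0 = 0\<close> makes the first kernel all of \<open>A\<close>, so the
  blocks exhaust \<open>A\<close>.\<close>

locale star_alg =
  fixes A :: "'a lcstar"
  assumes star_algebra: "star_algebra A"
begin

abbreviation C where "C \<equiv> lc_carrier A"
abbreviation zero ("\<zero>") where "\<zero> \<equiv> lc_zero A"
abbreviation add (infixl "\<oplus>" 65) where "x \<oplus> y \<equiv> lc_add A x y"
abbreviation sub (infixl "\<ominus>" 65) where "x \<ominus> y \<equiv> lc_sub A x y"
abbreviation mult (infixl "\<otimes>" 70) where "x \<otimes> y \<equiv> lc_mult A x y"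
abbreviation smult' (infixr "\<odot>" 75) where "c \<odot> x \<equiv> lc_smult A c x"
abbreviation star where "star x \<equiv> lc_star A x"

lemma zero_closed [simp]: "\<zero> \<in> C"
  and add_closed [simp]: "x \<in> C \<Longrightarrow> y \<in> C \<Longrightarrow> x \<oplus> y \<in> C"
  and mult_closed [simp]: "x \<in> C \<Longrightarrow> y \<in> C \<Longrightarrow> x \<otimes> y \<in> C"
  and smult_closed [simp]: "x \<in> C \<Longrightarrow> c \<odot> x \<in> C"
  and star_closed [simp]: "x \<in> C \<Longrightarrow> star x \<in> C"
  and add_assoc: "x \<in> C \<Longrightarrow> y \<in> C \<Longrightarrow> w \<in> C \<Longrightarrow> x \<oplus> y \<oplus> w = x \<oplus> (y \<oplus> w)"
  and add_commute: "x \<in> C \<Longrightarrow> y \<in> C \<Longrightarrow> x \<oplus> y = y \<oplus> x"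
  and zero_add [simp]: "x \<in> C \<Longrightarrow> \<zero> \<oplus> x = x"
  and right_neg [simp]: "x \<in> C \<Longrightarrow> x \<oplus> (-1) \<odot> x = \<zero>"
  and smult_add: "x \<in> C \<Longrightarrow> y \<in> C \<Longrightarrow> c \<odot> (x \<oplus> y) = c \<odot> x \<oplus> c \<odot> y"
  and add_smult: "x \<in> C \<Longrightarrow> (c + d) \<odot> x = c \<odot> x \<oplus> d \<odot> x"
  and smult_smult [simp]: "x \<in> C \<Longrightarrow> c \<odot> d \<odot> x = (c * d) \<odot> x"
  and one_smult [simp]: "x \<in> C \<Longrightarrow> 1 \<odot> x = x"
  and mult_assoc: "x \<in> C \<Longrightarrow> y \<in> C \<Longrightarrow> w \<in> C \<Longrightarrow> x \<otimes> y \<otimes> w = x \<otimes> (y \<otimes> w)"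
  and mult_add: "x \<in> C \<Longrightarrow> y \<in> C \<Longrightarrow> w \<in> C \<Longrightarrow> x \<otimes> (y \<oplus> w) = x \<otimes> y \<oplus> x \<otimes> w"
  and add_mult: "x \<in> C \<Longrightarrow> y \<in> C \<Longrightarrow> w \<in> C \<Longrightarrow> (x \<oplus> y) \<otimes> w = x \<otimes> w \<oplus> y \<otimes> w"
  and smult_mult [simp]: "x \<in> C \<Longrightarrow> y \<in> C \<Longrightarrow> c \<odot> x \<otimes> y = c \<odot> (x \<otimes> y)"
  and mult_smult [simp]: "x \<in> C \<Longrightarrow> y \<in> C \<Longrightarrow> x \<otimes> c \<odot> y = c \<odot> (x \<otimes> y)"
  and star_add: "x \<in> C \<Longrightarrow> y \<in> C \<Longrightarrow> star (x \<oplus> y) = star x \<oplus> star y"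
  and star_smult: "x \<in> C \<Longrightarrow> star (c \<odot> x) = cnj c \<odot> star x"
  and star_star [simp]: "x \<in> C \<Longrightarrow> star (star x) = x"
  and star_mult: "x \<in> C \<Longrightarrow> y \<in> C \<Longrightarrow> star (x \<otimes> y) = star y \<otimes> star x"
  using star_algebra unfolding star_algebra_def Let_def by auto

lemma add_left_commute:
  assumes "x \<in> C" "y \<in> C" "w \<in> C"
  shows "x \<oplus> (y \<oplus> w) = y \<oplus> (x \<oplus> w)"
  using assms by (metis add_assoc add_commute)

lemmas add_ac = add_assoc add_commute add_left_commute

lemma add_zero [simp]: "x \<in> C \<Longrightarrow> x \<oplus> \<zero> = x"
  using add_commute[of x "\<zero>"] by simp

lemma zero_smult [simp]: "x \<in> C \<Longrightarrow> 0 \<odot> x = \<zero>"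
  using add_smult[of x 1 "-1"] by simp

lemma smult_zero [simp]: "c \<odot> \<zero> = \<zero>"
  using smult_smult[of "\<zero>" c 0] by simp

lemma mult_zero [simp]: "x \<in> C \<Longrightarrow> x \<otimes> \<zero> = \<zero>"
  using mult_smult[of x "\<zero>" 0] by simp

lemma zero_mult [simp]: "x \<in> C \<Longrightarrow> \<zero> \<otimes> x = \<zero>"
  using smult_mult[of "\<zero>" x 0] by simp

lemma star_zero [simp]: "star \<zero> = \<zero>"
  using star_smult[of "\<zero>" 0] by simp

lemma star_eq_zero_iff [simp]: "x \<in> C \<Longrightarrow> star x = \<zero> \<longleftrightarrow> x = \<zero>"
  by (metis star_star star_zero)

lemma sub_closed [simp]: "x \<in> C \<Longrightarrow> y \<in> C \<Longrightarrow> x \<ominus> y \<in> C"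
  by (simp add: lc_sub_def)

lemma sub_self [simp]: "x \<in> C \<Longrightarrow> x \<ominus> x = \<zero>"
  by (simp add: lc_sub_def)

lemma sub_zero [simp]: "x \<in> C \<Longrightarrow> x \<ominus> \<zero> = x"
  by (simp add: lc_sub_def)

lemma add_left_neg [simp]:
  assumes "x \<in> C" "y \<in> C"
  shows "x \<oplus> ((-1) \<odot> x \<oplus> y) = y"
  using assms by (simp flip: add_assoc)

lemma neg_add_left [simp]:
  assumes "x \<in> C" "y \<in> C"
  shows "(-1) \<odot> x \<oplus> (x \<oplus> y) = y"
  using assms by (simp add: add_left_commute[of "(-1) \<odot> x"])

lemma sub_add_sub:
  assumes "x \<in> C" "y \<in> C" "w \<in> C"
  shows "(x \<ominus> y) \<oplus> (y \<ominus> w) = x \<ominus> w"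
  using assms by (simp add: lc_sub_def add_assoc)

lemma add_sub_cancel [simp]:
  assumes "x \<in> C" "y \<in> C"
  shows "x \<oplus> (y \<ominus> x) = y"
  using assms by (simp add: lc_sub_def add_left_commute[of x])

lemma add_sub_add:
  assumes "x \<in> C" "y \<in> C" "u \<in> C" "v \<in> C"
  shows "(x \<oplus> y) \<ominus> (u \<oplus> v) = (x \<ominus> u) \<oplus> (y \<ominus> v)"
  using assms by (simp add: lc_sub_def smult_add add_ac)

lemma sub_sub_cancel:
  assumes "x \<in> C" "y \<in> C"
  shows "x \<ominus> (x \<ominus> y) = y"
  using assms by (simp add: lc_sub_def smult_add)

lemma sub_sub_eq:
  assumes "x \<in> C" "y \<in> C" "w \<in> C"
  shows "x \<ominus> (y \<ominus> w) = (x \<oplus> w) \<ominus> y"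
  using assms by (simp add: lc_sub_def smult_add add_ac)

lemma sub_add_sub_add:
  assumes "x \<in> C" "u \<in> C" "u' \<in> C" "v \<in> C" "v' \<in> C"
  shows "(x \<ominus> (u \<oplus> u')) \<ominus> (v \<oplus> v') = ((x \<ominus> u) \<ominus> v) \<ominus> (u' \<oplus> v')"
  using assms by (simp add: lc_sub_def smult_add add_ac)

lemma sub_sub_sub:
  assumes "x \<in> C" "y \<in> C" "w \<in> C"
  shows "(x \<ominus> y) \<ominus> (x \<ominus> w) = w \<ominus> y"
  using assms
  by (simp add: lc_sub_def smult_add add_assoc add_left_commute[of "(-1) \<odot> y"] add_commute)

lemma smult_sub: "x \<in> C \<Longrightarrow> y \<in> C \<Longrightarrow> c \<odot> (x \<ominus> y) = c \<odot> x \<ominus> c \<odot> y"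
  by (simp add: lc_sub_def smult_add)

lemma mult_sub: "x \<in> C \<Longrightarrow> y \<in> C \<Longrightarrow> w \<in> C \<Longrightarrow> x \<otimes> (y \<ominus> w) = x \<otimes> y \<ominus> x \<otimes> w"
  by (simp add: lc_sub_def mult_add)

lemma sub_mult: "x \<in> C \<Longrightarrow> y \<in> C \<Longrightarrow> w \<in> C \<Longrightarrow> (x \<ominus> y) \<otimes> w = x \<otimes> w \<ominus> y \<otimes> w"
  by (simp add: lc_sub_def add_mult)

lemma star_sub: "x \<in> C \<Longrightarrow> y \<in> C \<Longrightarrow> star (x \<ominus> y) = star x \<ominus> star y"
  by (simp add: lc_sub_def star_add star_smult)

lemma sub_eq_zero_iff:
  assumes "x \<in> C" "y \<in> C"
  shows "x \<ominus> y = \<zero> \<longleftrightarrow> x = y"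
  using assms add_sub_cancel[of y x] by (metis add_zero sub_self)

lemma add_eq_iff_sub:
  assumes "x \<in> C" "y \<in> C" "w \<in> C"
  shows "x \<oplus> y = w \<longleftrightarrow> y = w \<ominus> x"
proof
  assume "x \<oplus> y = w"
  then show "y = w \<ominus> x" using assms by (auto simp: lc_sub_def add_commute[of "x \<oplus> y"])
qed (use assms in auto)

lemma subspace_sub:
  assumes "lc_subspace A S" "x \<in> S" "y \<in> S"
  shows "x \<ominus> y \<in> S"
  using assms by (auto simp: lc_subspace_def lc_sub_def)

lemma subspaceD:
  assumes "lc_subspace A S"
  shows "x \<in> S \<Longrightarrow> x \<in> C" "\<zero> \<in> S" "x \<in> S \<Longrightarrow> y \<in> S \<Longrightarrow> x \<oplus> y \<in> S" "x \<in> S \<Longrightarrow> c \<odot> x \<in> S"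
  using assms by (auto simp: lc_subspace_def)

end

section \<open>Consequences of the C*-identity for a single seminorm\<close>

locale star_alg_seminorm = star_alg +
  fixes p :: "'a \<Rightarrow> real"
  assumes c_star_seminorm: "c_star_seminorm A p"
begin

lemma nonneg [simp]: "x \<in> C \<Longrightarrow> 0 \<le> p x"
  and triangle: "x \<in> C \<Longrightarrow> y \<in> C \<Longrightarrow> p (x \<oplus> y) \<le> p x + p y"
  and p_smult: "x \<in> C \<Longrightarrow> p (c \<odot> x) = cmod c * p x"
  and p_mult: "x \<in> C \<Longrightarrow> y \<in> C \<Longrightarrow> p (x \<otimes> y) \<le> p x * p y"
  and p_star_mult: "x \<in> C \<Longrightarrow> p (star x \<otimes> x) = (p x)\<^sup>2"
  using c_star_seminorm unfolding c_star_seminorm_def by auto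

lemma p_le_0_iff [simp]: "x \<in> C \<Longrightarrow> p x \<le> 0 \<longleftrightarrow> p x = 0"
  using nonneg[of x] by linarith

lemma p_zero [simp]: "p \<zero> = 0"
  using p_smult[of "\<zero>" 0] by simp

text \<open>The C*-identity and submultiplicativity give
  \<open>(p x)\<^sup>2 \<le> p (star x) * p x\<close>; cancel \<open>p x\<close>. Used for
  \<open>star x\<close> as well, this makes the involution isometric.\<close>

lemma p_star_le:
  assumes "x \<in> C" shows "p x \<le> p (star x)"
proof (cases "p x = 0")
  case False
  then have "p x * p x \<le> p (star x) * p x"
    using p_star_mult[of x] p_mult[of "star x" x] assms by (simp add: power2_eq_square)
  moreover have "p x > 0" using False nonneg[OF assms] by simp
  ultimately show ?thesis by simp
qed (use assms in simp)

lemma p_star: "x \<in> C \<Longrightarrow> p (star x) = p x"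
  using p_star_le[of x] p_star_le[of "star x"] by simp

lemma p_sub_triangle:
  assumes "x \<in> C" "y \<in> C" "w \<in> C"
  shows "p (x \<ominus> w) \<le> p (x \<ominus> y) + p (y \<ominus> w)"
  using triangle[of "x \<ominus> y" "y \<ominus> w"] assms by (simp add: sub_add_sub)

lemma p_sub_commute:
  assumes "x \<in> C" "y \<in> C"
  shows "p (x \<ominus> y) = p (y \<ominus> x)"
proof -
  have "y \<ominus> x = (-1) \<odot> (x \<ominus> y)"
    using assms by (simp add: lc_sub_def smult_add add_commute)
  then show ?thesis using p_smult[of "x \<ominus> y" "-1"] assms by simp
qed

lemma p_sub_le: "x \<in> C \<Longrightarrow> y \<in> C \<Longrightarrow> p (x \<ominus> y) \<le> p x + p y"
  using triangle[of x "(-1) \<odot> y"] p_smult[of y "-1"] by (simp add: lc_sub_def)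

text \<open>Multiplying \<open>a \<oplus> b\<close> by \<open>star a\<close> removes
  \<open>b\<close>, so \<open>(p a)\<^sup>2\<close> is at most
  \<open>p a * p (a \<oplus> b)\<close>. Every norm estimate for components of a direct sum below
  comes from this.\<close>

lemma p_orthogonal_le:
  assumes "a \<in> C" "b \<in> C" "star a \<otimes> b = \<zero>"
  shows "p a \<le> p (a \<oplus> b)"
proof (cases "p a = 0")
  case False
  have "p a * p a \<le> p a * p (a \<oplus> b)"
    using p_star_mult[of a] p_mult[of "star a" "a \<oplus> b"] assms
    by (simp add: power2_eq_square mult_add p_star)
  moreover have "p a > 0" using False nonneg[OF assms(1)] by simp
  ultimately show ?thesis by simp
qed (use assms in simp)

end

text \<open>\<open>lc_topology\<close> is built with \<open>topology\<close>, so its defining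
  predicate becomes usable only after \<open>istopology\<close> is checked. For intersections, two
  finite families are united and the smaller radius is taken.\<close>

lemma openin_lc_topology:
  "openin (lc_topology A) U \<longleftrightarrow> U \<subseteq> lc_carrier A \<and>
     (\<forall>x\<in>U. \<exists>F e. finite F \<and> F \<subseteq> lc_seminorms A \<and> 0 < e \<and>
        {y \<in> lc_carrier A. \<forall>p\<in>F. p (lc_sub A y x) < e} \<subseteq> U)"
proof -
  let ?nb = "\<lambda>x F e. {y \<in> lc_carrier A. \<forall>p\<in>F. p (lc_sub A y x) < (e::real)}"
  let ?P = "\<lambda>U. U \<subseteq> lc_carrier A \<and>
     (\<forall>x\<in>U. \<exists>F e. finite F \<and> F \<subseteq> lc_seminorms A \<and> 0 < e \<and> ?nb x F e \<subseteq> U)"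
  have "istopology ?P"
    unfolding istopology_def
  proof (intro conjI allI impI)
    fix U V assume U: "?P U" and V: "?P V"
    have "\<exists>F e. finite F \<and> F \<subseteq> lc_seminorms A \<and> 0 < e \<and> ?nb x F e \<subseteq> U \<inter> V"
      if x: "x \<in> U \<inter> V" for x
    proof -
      obtain F e where F: "finite F" "F \<subseteq> lc_seminorms A" "0 < e" "?nb x F e \<subseteq> U"
        using U x by blast
      obtain G d where G: "finite G" "G \<subseteq> lc_seminorms A" "0 < d" "?nb x G d \<subseteq> V"
        using V x by blast
      have "?nb x (F \<union> G) (min e d) \<subseteq> ?nb x F e \<inter> ?nb x G d" by auto
      with F G show ?thesis
        by (intro exI[of _ "F \<union> G"] exI[of _ "min e d"]) auto
    qed
    then show "U \<inter> V \<subseteq> lc_carrier A"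
      "\<forall>x\<in>U \<inter> V. \<exists>F e. finite F \<and> F \<subseteq> lc_seminorms A \<and> 0 < e \<and> ?nb x F e \<subseteq> U \<inter> V"
      using U by auto
  next
    fix \<U> assume \<U>: "\<forall>K\<in>\<U>. ?P K"
    then show "\<Union>\<U> \<subseteq> lc_carrier A" by blast
    show "\<forall>x\<in>\<Union>\<U>. \<exists>F e. finite F \<and> F \<subseteq> lc_seminorms A \<and> 0 < e \<and> ?nb x F e \<subseteq> \<Union>\<U>"
    proof
      fix x assume "x \<in> \<Union>\<U>"
      then obtain K where "K \<in> \<U>" "x \<in> K" by blast
      moreover from this \<U> have "\<exists>F e. finite F \<and> F \<subseteq> lc_seminorms A \<and> 0 < e \<and> ?nb x F e \<subseteq> K"
        by blast
      ultimately show "\<exists>F e. finite F \<and> F \<subseteq> lc_seminorms A \<and> 0 < e \<and> ?nb x F e \<subseteq> \<Union>\<U>"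
        by (meson Sup_upper order_trans)
    qed
  qed
  then show ?thesis
    unfolding lc_topology_def by (simp add: topology_inverse')
qed

lemma topspace_lc_topology [simp]: "topspace (lc_topology A) = lc_carrier A"
proof
  show "topspace (lc_topology A) \<subseteq> lc_carrier A"
    using openin_topspace[of "lc_topology A"] openin_lc_topology by metis
  have "openin (lc_topology A) (lc_carrier A)"
    unfolding openin_lc_topology by (force intro: exI[of _ "{}"] exI[of _ 1])
  then show "lc_carrier A \<subseteq> topspace (lc_topology A)"
    by (rule openin_subset)
qed

subsection \<open>Norm and spectrum of a selfadjoint element\<close>

lemma sum_root_unity_powers:
  assumes "0 < L"
  shows "(\<Sum>k<L. cis (2 * pi * real k / real L) ^ m) = (if L dvd m then of_nat L else 0)"
proof -
  let ?w = "\<lambda>j. cis (2 * pi * real j / real L)"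
  have pow: "?w k ^ m = ?w m ^ k" for k
    by (simp add: Complex.DeMoivre mult_ac)
  have L: "?w m ^ L = 1"
    using assms by (simp add: Complex.DeMoivre cis_multiple_2pi)
  have one: "?w m = 1 \<longleftrightarrow> L dvd m"
    using complex_root_unity_eq_1[of L m] assms by (simp add: cis_conv_exp mult_ac)
  show ?thesis
  proof (cases "L dvd m")
    case False
    then have "?w m \<noteq> 1" using one by simp
    then show ?thesis
      unfolding pow using L geometric_sum[of "?w m" L] False by simp
  qed (unfold pow, use one in simp)
qed

lemma linear_poly_power: "[:0, c:] ^ j = monom (c ^ j) j" for c :: "'a::comm_semiring_1"
  by (induction j) (simp_all add: monom_Suc one_pCons monom_0 mult_ac smult_monom)

lemma pCons_0_sum: "pCons 0 (\<Sum>i\<in>I. f i) = (\<Sum>i\<in>I. pCons 0 (f i))"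
  by (induction I rule: infinite_finite_induct) (simp_all, metis add.right_neutral add_pCons)

text \<open>The truncation of \<open>1 / (1 - c X)\<close> to degree below \<open>K\<close>.\<close>

definition geom_poly :: "nat \<Rightarrow> complex \<Rightarrow> complex poly" where
  "geom_poly K c = (\<Sum>j<K. [:0, c:] ^ j)"

lemma coeff_geom_poly: "coeff (geom_poly K c) j = (if j < K then c ^ j else 0)"
  by (simp add: geom_poly_def linear_poly_power coeff_sum if_distrib cong: if_cong)

text \<open>The telescoping identity \<open>(1 - c X) g = 1 - (c X)^K\<close>, solved for
  \<open>g\<close> in the form of a fixed point equation, which survives evaluation at
  \<open>y\<close>.\<close>

lemma geom_poly_telescope: "geom_poly K c = 1 - monom (c ^ K) K + smult c (pCons 0 (geom_poly K c))"
proof -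
  have "(1 - [:0, c:]) * geom_poly K c = 1 - [:0, c:] ^ K"
    unfolding geom_poly_def by (rule one_diff_power_eq[symmetric])
  then show ?thesis
    by (simp add: left_diff_distrib linear_poly_power algebra_simps)
qed

text \<open>The set counts the ways to write \<open>n\<close> as a sum of two exponents below
  \<open>K\<close>; \<open>n < K + i\<close> says that the second exponent \<open>n - i\<close> is
  below \<open>K\<close>.\<close>

lemma coeff_geom_poly_sq:
  "coeff (geom_poly K c ^ 2) n = of_nat (card {i. i < K \<and> i \<le> n \<and> n < K + i}) * c ^ n"
proof -
  have "coeff (geom_poly K c ^ 2) n
      = (\<Sum>i\<le>n. if i < K \<and> n < K + i then c ^ n else 0)"
    unfolding power2_eq_square coeff_mult
    by (rule sum.cong) (auto simp: coeff_geom_poly simp flip: power_add)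
  also have "\<dots> = (\<Sum>i\<in>{i. i < K \<and> i \<le> n \<and> n < K + i}. c ^ n)"
    by (rule sum.mono_neutral_cong_right) auto
  finally show ?thesis by simp
qed

text \<open>A discrete Fourier coefficient. The square has degree at most \<open>2 K - 2\<close>,
  and in that range only \<open>n = K - 1\<close> makes \<open>K + 1 + n\<close> a multiple of
  \<open>2 K\<close>. This is the peak of the triangular coefficient sequence, with value
  \<open>K\<close>. Squaring is what produces a coefficient that grows with
  \<open>K\<close>.\<close>

lemma geom_poly_sq_average:
  assumes "0 < K"
  shows "(\<Sum>k<2*K. smult (cis (2 * pi * real k / real (2*K)) ^ (K + 1) / of_nat (2*K))
             (geom_poly K (cis (2 * pi * real k / real (2*K))) ^ 2)) = monom (of_nat K) (K - 1)"
proof (rule poly_eqI)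
  fix n
  let ?w = "\<lambda>k. cis (2 * pi * real k / real (2 * K))"
  let ?d = "card {i. i < K \<and> i \<le> n \<and> n < K + i}"
  have "coeff (\<Sum>k<2*K. smult (?w k ^ (K + 1) / of_nat (2*K)) (geom_poly K (?w k) ^ 2)) n
      = of_nat ?d / of_nat (2*K) * (\<Sum>k<2*K. ?w k ^ (K + 1 + n))"
    by (simp add: coeff_sum coeff_geom_poly_sq sum_distrib_left power_add mult_ac)
  also have "\<dots> = of_nat ?d * (if 2 * K dvd K + 1 + n then 1 else 0)"
    using sum_root_unity_powers[of "2*K" "K+1+n"] assms by simp
  also have "\<dots> = coeff (monom (of_nat K) (K - 1)) n"
  proof (cases "n < 2 * K")
    case True
    show ?thesis
    proof (cases "n = K - 1")
      case True
      then have "{i. i < K \<and> i \<le> n \<and> n < K + i} = {..<K}" using assms by auto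
      then show ?thesis using True assms by (simp add: mult_2)
    next
      case False
      have "\<not> 2 * K dvd K + 1 + n"
      proof
        assume "2 * K dvd K + 1 + n"
        then obtain r where r: "K + 1 + n = 2 * K * r" by blast
        \<comment> \<open>With \<open>n < 2 K\<close> the number \<open>K + 1 + n\<close> lies
          strictly between 0 and \<open>4 K\<close>.\<close>
        have "r = 1"
        proof (cases r)
          case (Suc r')
          then show ?thesis using r True assms by (cases r') auto
        qed (use r in simp)
        with r False show False by simp
      qed
      then show ?thesis using False by simp
    qed
  next
    case False
    then have "{i. i < K \<and> i \<le> n \<and> n < K + i} = {}" by auto
    with False show ?thesis using assms by auto
  qed
  finally show "coeff (\<Sum>k<2*K. smult (?w k ^ (K + 1) / of_nat (2*K)) (geom_poly K (?w k) ^ 2)) n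
      = coeff (monom (of_nat K) (K - 1)) n" .
qed

section \<open>Polynomial evaluation in an algebra without unit\<close>

context star_alg
begin

text \<open>Since \<open>A\<close> need not have a unit, a polynomial \<open>r\<close> is evaluated as \<open>y r(y)\<close>.\<close>

definition ev :: "'a \<Rightarrow> complex poly \<Rightarrow> 'a" where
  "ev y r = fold_coeffs (\<lambda>c a. c \<odot> y \<oplus> y \<otimes> a) r \<zero>"

lemma ev_0 [simp]: "ev y 0 = \<zero>"
  by (simp add: ev_def)

lemma ev_pCons: "y \<in> C \<Longrightarrow> ev y (pCons c r) = c \<odot> y \<oplus> y \<otimes> ev y r"
  by (cases "c = 0"; cases "r = 0") (simp_all add: ev_def)

lemma ev_closed [simp]: "y \<in> C \<Longrightarrow> ev y r \<in> C"
  by (induction r) (simp_all add: ev_pCons)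

lemma ev_pCons_0: "y \<in> C \<Longrightarrow> ev y (pCons 0 r) = y \<otimes> ev y r"
  by (simp add: ev_pCons)

lemma ev_add: "y \<in> C \<Longrightarrow> ev y (r + s) = ev y r \<oplus> ev y s"
  by (induction r s rule: poly_induct2) (simp_all add: ev_pCons add_smult mult_add add_ac)

lemma ev_smult: "y \<in> C \<Longrightarrow> ev y (smult c r) = c \<odot> ev y r"
  by (induction r) (simp_all add: ev_pCons smult_add)

lemma ev_diff: "y \<in> C \<Longrightarrow> ev y (r - s) = ev y r \<ominus> ev y s"
  using ev_add[of y r "smult (-1) s"] ev_smult[of y "-1" s] by (simp add: lc_sub_def)

text \<open>Both factors carry the extra \<open>y\<close>, so their product carries two; the surplus
  one becomes the shift \<open>pCons 0\<close>.\<close>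

lemma ev_mult: "y \<in> C \<Longrightarrow> ev y r \<otimes> ev y s = ev y (pCons 0 (r * s))"
  by (induction r) (simp_all add: ev_pCons add_mult ev_add ev_smult mult_add mult_assoc)

lemma ev_one: "y \<in> C \<Longrightarrow> ev y 1 = y"
  by (simp add: one_pCons ev_pCons)

text \<open>The involution reverses the order of factors, so one \<open>y\<close> has to move from
  the right end to the left. Reading it as \<open>ev y 1\<close> lets \<open>ev_mult\<close> do
  this.\<close>

lemma ev_monom_star:
  assumes "y \<in> C" "star y = y"
  shows "star (ev y (monom 1 n)) = ev y (monom 1 n)"
proof (induction n)
  case 0
  then show ?case using assms by (simp add: ev_one flip: one_pCons add: monom_0)
next
  case (Suc n)
  have "star (ev y (monom 1 (Suc n))) = ev y (monom 1 n) \<otimes> ev y 1"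
    using assms Suc by (simp add: monom_Suc ev_pCons_0 star_mult ev_one)
  then show ?case
    using assms(1) by (simp only: ev_mult) (simp add: monom_Suc)
qed

end

context star_alg_seminorm
begin

lemma p_ev_sum_le:
  assumes "y \<in> C" "finite I"
  shows "p (ev y (\<Sum>i\<in>I. f i)) \<le> (\<Sum>i\<in>I. p (ev y (f i)))"
  using assms(2)
proof (induction I rule: finite_induct)
  case (insert i I)
  then show ?case
    using triangle[of "ev y (f i)" "ev y (sum f I)"] assms(1) by (simp add: ev_add)
qed simp

lemma p_ev_monom_le:
  assumes "y \<in> C" "p y \<le> 1"
  shows "p (ev y (monom 1 n)) \<le> 1"
proof (induction n)
  case 0
  then show ?case using assms by (simp add: ev_one flip: one_pCons add: monom_0)
next
  case (Suc n)
  have "p (y \<otimes> ev y (monom 1 n)) \<le> p y * p (ev y (monom 1 n))"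
    using p_mult assms by simp
  also have "\<dots> \<le> 1" using Suc assms by (simp add: mult_le_one)
  finally show ?case using assms by (simp add: monom_Suc ev_pCons_0)
qed

text \<open>The evaluated element is the power of \<open>y\<close> with exponent
  \<open>2 ^ n\<close>, because \<open>ev\<close> adds one factor. For a selfadjoint element the
  C*-identity squares the seminorm each time the exponent doubles.\<close>

lemma p_ev_monom_eq_1:
  assumes "y \<in> C" "star y = y" "p y = 1"
  shows "p (ev y (monom 1 (2 ^ n - 1))) = 1"
proof (induction n)
  case 0
  then show ?case using assms by (simp add: ev_one flip: one_pCons add: monom_0)
next
  case (Suc n)
  let ?m = "monom (1::complex) (2 ^ n - 1)"
  have "Suc ((2 ^ n - 1) + (2 ^ n - 1)) = 2 ^ Suc n - (1::nat)"
    by (cases "2 ^ n :: nat") auto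
  then have "monom 1 (2 ^ Suc n - 1) = pCons 0 (?m * ?m)"
    by (simp add: mult_monom flip: monom_Suc)
  then have "ev y (monom 1 (2 ^ Suc n - 1)) = star (ev y ?m) \<otimes> ev y ?m"
    using assms by (simp add: ev_monom_star ev_mult)
  then show ?case using p_star_mult[of "ev y ?m"] assms(1) Suc by simp
qed

text \<open>With a unit adjoined, the hypothesis reads \<open>(1 + b) (1 - c y) = 1 + e\<close> with
  \<open>p e \<le> 1 / 2\<close>, and the geometric sum \<open>s\<close> satisfies
  \<open>(1 - c y) s = r\<close> where \<open>r\<close> is \<open>y\<close> minus a multiple of a
  power of \<open>y\<close>. Hence \<open>s = (1 + b) r - e s\<close>. The bound follows from
  \<open>p r \<le> 2\<close> after absorbing half of \<open>p s\<close>; it does not depend on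
  \<open>K\<close>.\<close>

lemma p_ev_geom_poly_le:
  assumes y: "y \<in> C" "p y \<le> 1" and c: "cmod c = 1"
    and b: "b \<in> C" and e: "p ((b \<ominus> c \<odot> (b \<otimes> y)) \<ominus> c \<odot> y) \<le> 1 / 2"
  shows "p (ev y (geom_poly K c)) \<le> 4 * (1 + p b)"
proof -
  define s where "s = ev y (geom_poly K c)"
  define r where "r = ev y (1 - monom (c ^ K) K)"
  let ?e = "(b \<ominus> c \<odot> (b \<otimes> y)) \<ominus> c \<odot> y"
  have sr [simp]: "s \<in> C" "r \<in> C" using y by (auto simp: s_def r_def)
  have "s = r \<oplus> c \<odot> (y \<otimes> s)"
    using y geom_poly_telescope[of K c] unfolding s_def r_def
    by (metis ev_add ev_smult ev_pCons_0)
  then have cys: "c \<odot> (y \<otimes> s) = s \<ominus> r"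
    using add_eq_iff_sub[of r "c \<odot> (y \<otimes> s)" s] y by simp
  \<comment> \<open>Expanding \<open>(1 + b) (1 - c y) s\<close> without a unit: each
    \<open>c y s\<close> is replaced by \<open>s - r\<close>.\<close>
  have "?e \<otimes> s = (b \<otimes> s \<ominus> b \<otimes> (c \<odot> (y \<otimes> s))) \<ominus> c \<odot> (y \<otimes> s)"
    using y b by (simp add: sub_mult mult_assoc)
  also have "\<dots> = (b \<otimes> r \<oplus> r) \<ominus> s"
    unfolding cys using b by (simp add: mult_sub sub_sub_cancel sub_sub_eq)
  finally have "s = (b \<otimes> r \<oplus> r) \<ominus> ?e \<otimes> s"
    using b y by (simp add: sub_sub_cancel)
  then have "p s \<le> p (b \<otimes> r \<oplus> r) + p (?e \<otimes> s)"
    using p_sub_le[of "b \<otimes> r \<oplus> r" "?e \<otimes> s"] b y by simp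
  also have "\<dots> \<le> (p b * p r + p r) + p ?e * p s"
    using triangle[of "b \<otimes> r" r] p_mult[of b r] p_mult[of ?e s] b y by fastforce
  also have "\<dots> \<le> (p b * 2 + 2) + 1 / 2 * p s"
  proof -
    have "p r \<le> p (ev y 1) + p (ev y (smult (c ^ K) (monom 1 K)))"
      unfolding r_def using y p_sub_le[of "ev y 1" "ev y (monom (c ^ K) K)"]
      by (simp add: ev_diff smult_monom)
    also have "\<dots> \<le> 2"
      using y p_ev_monom_le[OF y, of K] c
      by (simp only: ev_smult p_smult ev_closed norm_power) (simp add: ev_one)
    finally have "p r \<le> 2" .
    then show ?thesis
      using b e by (intro add_mono mult_left_mono mult_right_mono) auto
  qed
  finally show ?thesis by (simp add: s_def)
qed

text \<open>Compactness of the circle. If no bound \<open>N\<close> worked for all scalars, bad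
  scalars would accumulate at some \<open>l\<close>; but an element \<open>b\<close> that is good
  for \<open>l\<close> stays good nearby, with the same value of \<open>p b\<close>.\<close>

lemma sphere_uniform_bound:
  assumes y: "y \<in> C"
    and ex: "\<And>c. cmod c = 1 \<Longrightarrow> \<exists>b\<in>C. p ((b \<ominus> c \<odot> (b \<otimes> y)) \<ominus> c \<odot> y) < 1 / 2"
  shows "\<exists>N::nat. \<forall>c. cmod c = 1 \<longrightarrow>
           (\<exists>b\<in>C. p b \<le> N \<and> p ((b \<ominus> c \<odot> (b \<otimes> y)) \<ominus> c \<odot> y) < 1 / 2)"
proof (rule ccontr)
  let ?E = "\<lambda>b c. p ((b \<ominus> c \<odot> (b \<otimes> y)) \<ominus> c \<odot> y)"
  assume "\<not> ?thesis"
  then have "\<forall>N::nat. \<exists>c. c \<in> sphere 0 1 \<and> (\<forall>b\<in>C. p b \<le> N \<longrightarrow> \<not> ?E b c < 1 / 2)"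
    by auto
  then obtain c where c: "\<And>N. c N \<in> sphere (0::complex) 1"
    and none: "\<And>N b. b \<in> C \<Longrightarrow> p b \<le> real N \<Longrightarrow> \<not> ?E b (c N) < 1 / 2"
    by metis
  have "seq_compact (sphere (0::complex) 1)"
    using compact_sphere compact_imp_seq_compact by blast
  then obtain l r where l: "l \<in> sphere 0 1" and r: "strict_mono r" and lim: "(c \<circ> r) \<longlonglongrightarrow> l"
    using c unfolding seq_compact_def by metis
  obtain b where b: "b \<in> C" "?E b l < 1 / 2" using ex[of l] l by auto
  \<comment> \<open>For fixed \<open>b\<close> the defect is Lipschitz in the scalar.\<close>
  have lip: "?E b d \<le> ?E b l + cmod (d - l) * (p (b \<otimes> y) + p y)" for d
  proof -
    have "(b \<ominus> d \<odot> (b \<otimes> y)) \<ominus> d \<odot> y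
        = ((b \<ominus> l \<odot> (b \<otimes> y)) \<ominus> l \<odot> y) \<ominus> (d - l) \<odot> (b \<otimes> y \<oplus> y)"
    proof -
      have "d \<odot> u = l \<odot> u \<oplus> (d - l) \<odot> u" if "u \<in> C" for u
        using add_smult[OF that, of l "d - l"] by simp
      from this[of y] this[of "b \<otimes> y"] show ?thesis
        using b(1) y by (simp add: smult_add sub_add_sub_add)
    qed
    then have "?E b d \<le> ?E b l + p ((d - l) \<odot> (b \<otimes> y \<oplus> y))"
      using p_sub_le[of "(b \<ominus> l \<odot> (b \<otimes> y)) \<ominus> l \<odot> y" "(d - l) \<odot> (b \<otimes> y \<oplus> y)"] b(1) y by simp
    also have "\<dots> \<le> ?E b l + cmod (d - l) * (p (b \<otimes> y) + p y)"
      using triangle[of "b \<otimes> y" y] b(1) y by (simp add: p_smult mult_left_mono)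
    finally show ?thesis .
  qed
  have "(\<lambda>n. ?E b l + cmod (c (r n) - l) * (p (b \<otimes> y) + p y))
      \<longlonglongrightarrow> ?E b l + cmod (l - l) * (p (b \<otimes> y) + p y)"
    using lim unfolding o_def by (intro tendsto_intros)
  then have "\<forall>\<^sub>F n in sequentially. ?E b l + cmod (c (r n) - l) * (p (b \<otimes> y) + p y) < 1 / 2"
    using b(2) by (intro order_tendstoD(2)) auto
  moreover have "\<forall>\<^sub>F n in sequentially. p b \<le> real n"
    using eventually_ge_at_top[of "nat \<lceil>p b\<rceil>"] by eventually_elim linarith
  ultimately have "\<forall>\<^sub>F n::nat in sequentially. False"
  proof eventually_elim
    case (elim n)
    have "?E b (c (r n)) < 1 / 2" using lip[of "c (r n)"] elim(1) by linarith
    moreover have "p b \<le> real (r n)"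
      using elim(2) seq_suble[OF r, of n] by linarith
    ultimately show ?case using none b(1) by blast
  qed
  then show False by simp
qed

text \<open>
  The spectral radius of a selfadjoint element is its norm, in a form that does not need
  completeness. Otherwise the geometric sums in \<open>c y\<close> are bounded uniformly in \<open>c\<close>
  on the unit circle, and averaging their squares against roots of unity isolates a single
  power of \<open>y\<close> with an arbitrarily large coefficient.
\<close>

lemma selfadjoint_spectral_value:
  assumes y: "y \<in> C" "star y = y" "p y = 1"
  shows "\<exists>c. cmod c = 1 \<and> (\<forall>b\<in>C. 1 / 2 \<le> p ((b \<ominus> c \<odot> (b \<otimes> y)) \<ominus> c \<odot> y))"
proof (rule ccontr)
  assume "\<not> ?thesis"
  then have "\<And>c. cmod c = 1 \<Longrightarrow> \<exists>b\<in>C. p ((b \<ominus> c \<odot> (b \<otimes> y)) \<ominus> c \<odot> y) < 1 / 2"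
    by (meson not_le)
  then obtain N :: nat where N: "\<And>c. cmod c = 1 \<Longrightarrow>
      \<exists>b\<in>C. p b \<le> N \<and> p ((b \<ominus> c \<odot> (b \<otimes> y)) \<ominus> c \<odot> y) < 1 / 2"
    using sphere_uniform_bound[OF y(1)] by blast
  \<comment> \<open>The bound of \<open>p_ev_geom_poly_le\<close>, uniform in \<open>c\<close> and
    in the length of the sum.\<close>
  define \<beta> where "\<beta> = 4 * (1 + real N)"
  have geom: "p (ev y (geom_poly K c)) \<le> \<beta>" if c: "cmod c = 1" for K c
  proof -
    obtain b where b: "b \<in> C" "p b \<le> N" "p ((b \<ominus> c \<odot> (b \<otimes> y)) \<ominus> c \<odot> y) < 1 / 2"
      using N[OF c] by blast
    show ?thesis
      using p_ev_geom_poly_le[OF y(1) _ c b(1), of K] y(3) b unfolding \<beta>_def by simp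
  qed
  obtain n where n: "\<beta>\<^sup>2 + 1 < 2 ^ n" using real_arch_pow[of 2] by auto
  \<comment> \<open>This form of \<open>K\<close> makes \<open>ev y (monom 1 K)\<close> have
    seminorm 1 by \<open>p_ev_monom_eq_1\<close>. The choice of \<open>n\<close> puts
    \<open>K\<close> above the square of \<open>\<beta>\<close>, while the average below can be at
    most that square.\<close>
  define K :: nat where "K = 2 ^ n - 1"
  have K: "\<beta>\<^sup>2 < K" using n by (simp add: K_def of_nat_diff)
  then have K0: "0 < K" by (cases K) (auto simp: not_less)
  let ?w = "\<lambda>k. cis (2 * pi * real k / real (2 * K))"
  let ?t = "\<lambda>k. smult (?w k ^ (K + 1) / of_nat (2 * K)) (geom_poly K (?w k) ^ 2)"
  \<comment> \<open>The shift matches the one in \<open>ev_mult\<close>, so that each summand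
    evaluates to a multiple of a product of two geometric sums in \<open>y\<close>.\<close>
  have "pCons 0 (\<Sum>k<2*K. ?t k) = pCons 0 (monom (of_nat K) (K - 1))"
    using geom_poly_sq_average[OF K0] by simp
  also have "\<dots> = smult (of_nat K) (monom 1 K)"
    using K0 by (simp add: smult_monom flip: monom_Suc)
  finally have avg: "smult (of_nat K) (monom 1 K) = (\<Sum>k<2*K. pCons 0 (?t k))"
    by (simp add: pCons_0_sum)
  have "real K = p (ev y (smult (of_nat K) (monom 1 K)))"
    using p_ev_monom_eq_1[OF y, of n, folded K_def] y(1) by (simp add: ev_smult p_smult)
  also have "\<dots> \<le> (\<Sum>k<2*K. p (ev y (pCons 0 (?t k))))"
    unfolding avg using y(1) by (intro p_ev_sum_le) auto
  also have "\<dots> \<le> (\<Sum>k<2*K. \<beta>\<^sup>2 / real (2 * K))"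
  proof (rule sum_mono)
    fix k
    let ?g = "geom_poly K (?w k)"
    have "ev y (pCons 0 (?t k)) = (?w k ^ (K + 1) / of_nat (2 * K)) \<odot> (ev y ?g \<otimes> ev y ?g)"
      using y(1) by (simp add: ev_mult ev_smult power2_eq_square flip: ev_smult)
    then have "p (ev y (pCons 0 (?t k))) = p (ev y ?g \<otimes> ev y ?g) / real (2 * K)"
      using y(1) by (simp add: p_smult norm_divide norm_mult norm_power)
    also have "\<dots> \<le> \<beta>\<^sup>2 / real (2 * K)"
    proof (rule divide_right_mono)
      have "p (ev y ?g \<otimes> ev y ?g) \<le> p (ev y ?g) * p (ev y ?g)"
        using p_mult y(1) by simp
      also have "\<dots> \<le> \<beta>\<^sup>2"
        unfolding power2_eq_square using geom[of "?w k" K] y(1) by (intro mult_mono) (auto simp: \<beta>_def)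
      finally show "p (ev y ?g \<otimes> ev y ?g) \<le> \<beta>\<^sup>2" .
    qed simp
    finally show "p (ev y (pCons 0 (?t k))) \<le> \<beta>\<^sup>2 / real (2 * K)" .
  qed
  also have "\<dots> = \<beta>\<^sup>2" using K0 by simp
  finally show False using K by simp
qed

end

subsection \<open>Topologies given by an increasing sequence of seminorms\<close>

text \<open>Monotone rather than strictly monotone, so that a constant sequence is allowed: the
  summands, with their single norm, are instances too.\<close>

locale star_alg_seq = star_alg +
  fixes q :: "nat \<Rightarrow> 'a \<Rightarrow> real"
  assumes seminorms: "lc_seminorms A = range q"
    and q_c_star: "c_star_seminorm A (q n)"
    and q_mono: "m \<le> n \<Longrightarrow> x \<in> C \<Longrightarrow> q m x \<le> q n x"
    and q_separating: "x \<in> C \<Longrightarrow> (\<And>n. q n x = 0) \<Longrightarrow> x = \<zero>"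
begin

sublocale star_alg_seminorm A "q n" for n
  by unfold_locales (rule q_c_star)

lemma star_mult_eq_zero:
  assumes "x \<in> C" "star x \<otimes> x = \<zero>"
  shows "x = \<zero>"
proof (rule q_separating)
  show "q n x = 0" for n
    using p_star_mult[of x n] assms by simp
qed (use assms in simp)

text \<open>The largest index occurring in the family dominates it. Neighbourhoods can therefore be
  described by one seminorm at a time.\<close>

lemma finite_seminorms_bound:
  assumes "finite F" "F \<subseteq> range q"
  shows "\<exists>n. \<forall>p\<in>F. \<forall>x\<in>C. p x \<le> q n x"
  using assms
proof (induction F rule: finite_induct)
  case (insert p F)
  then obtain n m where n: "\<forall>p\<in>F. \<forall>x\<in>C. p x \<le> q n x" and m: "p = q m" by auto
  have "q n x \<le> q (max m n) x" "q m x \<le> q (max m n) x" if "x \<in> C" for x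
    using that by (auto intro: q_mono)
  then show ?case
    using n m order_trans by (intro exI[of _ "max m n"]) blast
qed simp

lemma openin_iff:
  "openin (lc_topology A) U \<longleftrightarrow> U \<subseteq> C \<and>
     (\<forall>x\<in>U. \<exists>n e. 0 < e \<and> {y \<in> C. q n (y \<ominus> x) < e} \<subseteq> U)"
proof -
  have iff: "(\<exists>F e. finite F \<and> F \<subseteq> range q \<and> 0 < e \<and> {y \<in> C. \<forall>p\<in>F. p (y \<ominus> x) < e} \<subseteq> U)
    \<longleftrightarrow> (\<exists>n e. 0 < e \<and> {y \<in> C. q n (y \<ominus> x) < e} \<subseteq> U)" (is "?L \<longleftrightarrow> ?R")
    if U: "U \<subseteq> C" and x: "x \<in> U" for x
  proof
    assume ?L
    then obtain F e where F: "finite F" "F \<subseteq> range q" "0 < e" "{y \<in> C. \<forall>p\<in>F. p (y \<ominus> x) < e} \<subseteq> U"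
      by (elim exE conjE)
    obtain n where n: "\<forall>p\<in>F. \<forall>x\<in>C. p x \<le> q n x"
      using finite_seminorms_bound[OF F(1,2)] by (elim exE)
    have "{y \<in> C. q n (y \<ominus> x) < e} \<subseteq> {y \<in> C. \<forall>p\<in>F. p (y \<ominus> x) < e}"
    proof clarify
      fix y p assume "y \<in> C" "q n (y \<ominus> x) < e" "p \<in> F"
      moreover have "y \<ominus> x \<in> C" using \<open>y \<in> C\<close> x U by auto
      ultimately show "p (y \<ominus> x) < e" using n by (meson le_less_trans)
    qed
    then show ?R using F(3,4) by (intro exI[of _ n] exI[of _ e]) (auto elim: order_trans)
  next
    assume ?R
    then obtain n e where "0 < e" "{y \<in> C. q n (y \<ominus> x) < e} \<subseteq> U" by (elim exE conjE)
    then show ?L by (intro exI[of _ "{q n}"] exI[of _ e]) simp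
  qed
  then show ?thesis
    unfolding openin_lc_topology seminorms
    by (intro conj_cong ball_cong refl) (erule (1) iff)
qed

lemma openin_ball:
  assumes "x \<in> C"
  shows "openin (lc_topology A) {y \<in> C. q n (y \<ominus> x) < e}"
  unfolding openin_iff
proof (intro conjI ballI)
  fix y assume y: "y \<in> {y \<in> C. q n (y \<ominus> x) < e}"
  have "{w \<in> C. q n (w \<ominus> y) < e - q n (y \<ominus> x)} \<subseteq> {y \<in> C. q n (y \<ominus> x) < e}"
  proof clarify
    fix w assume "w \<in> C" "q n (w \<ominus> y) < e - q n (y \<ominus> x)"
    then show "q n (w \<ominus> x) < e"
      using p_sub_triangle[of w y x n] y assms by simp
  qed
  then show "\<exists>m d. 0 < d \<and> {w \<in> C. q m (w \<ominus> y) < d} \<subseteq> {y \<in> C. q n (y \<ominus> x) < e}"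
    using y by (intro exI[of _ n] exI[of _ "e - q n (y \<ominus> x)"]) simp
qed auto

text \<open>The closure in \<open>lc_topology A\<close>, in a form suited to estimates; since
  \<open>q\<close> increases, testing one index at a time gives the same set as testing finite
  families.\<close>

definition cl :: "'a set \<Rightarrow> 'a set" where
  "cl S = {x \<in> C. \<forall>n e. 0 < e \<longrightarrow> (\<exists>y\<in>S. q n (x \<ominus> y) < e)}"

lemma cl_subset_carrier: "cl S \<subseteq> C"
  by (auto simp: cl_def)

lemma subset_cl: "S \<subseteq> C \<Longrightarrow> S \<subseteq> cl S"
  unfolding cl_def by (auto intro!: bexI)

lemma closedin_iff: "closedin (lc_topology A) S \<longleftrightarrow> S \<subseteq> C \<and> cl S \<subseteq> S"
proof -
  have *: "(\<forall>x\<in>C - S. \<exists>n e. 0 < e \<and> {y \<in> C. q n (y \<ominus> x) < e} \<subseteq> C - S) \<longleftrightarrow> cl S \<subseteq> S"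
    if "S \<subseteq> C"
  proof -
    have "(\<exists>n e. 0 < e \<and> {y \<in> C. q n (y \<ominus> x) < e} \<subseteq> C - S) \<longleftrightarrow> x \<notin> cl S" if x: "x \<in> C" for x
    proof -
      have "{y \<in> C. q n (y \<ominus> x) < e} \<subseteq> C - S \<longleftrightarrow> (\<forall>y\<in>S. \<not> q n (x \<ominus> y) < e)" for n e
      proof -
        have "{y \<in> C. q n (y \<ominus> x) < e} \<subseteq> C - S \<longleftrightarrow> (\<forall>y\<in>C. q n (y \<ominus> x) < e \<longrightarrow> y \<notin> S)"
          by blast
        also have "\<dots> \<longleftrightarrow> (\<forall>y\<in>C. q n (x \<ominus> y) < e \<longrightarrow> y \<notin> S)"
          using p_sub_commute[OF x] by simp
        finally show ?thesis using \<open>S \<subseteq> C\<close> by blast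
      qed
      then show ?thesis using x unfolding cl_def by simp
    qed
    then show ?thesis using cl_subset_carrier by blast
  qed
  then show ?thesis
    unfolding closedin_def openin_iff topspace_lc_topology
    by (intro conj_cong refl) (simp only: * Diff_subset simp_thms)
qed

lemma clI: "x \<in> C \<Longrightarrow> (\<And>n e. 0 < e \<Longrightarrow> \<exists>y\<in>S. q n (x \<ominus> y) < e) \<Longrightarrow> x \<in> cl S"
  by (simp add: cl_def)

lemma clE:
  assumes "x \<in> cl S" "0 < e"
  obtains y where "y \<in> S" "q n (x \<ominus> y) < e"
  using assms unfolding cl_def by blast

lemma cl_cl:
  assumes "S \<subseteq> C"
  shows "cl (cl S) \<subseteq> cl S"
proof
  fix x assume x: "x \<in> cl (cl S)"
  then have xC: "x \<in> C" using cl_subset_carrier by blast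
  then show "x \<in> cl S"
  proof (rule clI)
    fix n and e :: real assume e: "0 < e"
    then obtain w where w: "w \<in> cl S" "q n (x \<ominus> w) < e / 2"
      using clE[OF x, of "e / 2" n] by auto
    obtain y where y: "y \<in> S" "q n (w \<ominus> y) < e / 2"
      using clE[OF w(1), of "e / 2" n] e by auto
    have "q n (x \<ominus> y) < e"
      using p_sub_triangle[of x w y n] xC w y assms cl_subset_carrier by fastforce
    then show "\<exists>y\<in>S. q n (x \<ominus> y) < e" using y by blast
  qed
qed

text \<open>Dividing by \<open>r + 1\<close> covers \<open>r = 0\<close>. In the applications
  \<open>r\<close> is the size of a fixed factor or scalar.\<close>

lemma small_multiple:
  assumes "0 < e" "0 \<le> (r::real)"
  obtains d where "0 < d" "r * d < e"
proof
  show "0 < e / (r + 1)" using assms by simp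
  show "r * (e / (r + 1)) < e" using assms by (simp add: field_simps)
qed

text \<open>The annihilator condition speaks of closed ideals, whereas the ideals built below are
  given algebraically. Each operation moves approximations to approximations, with the error scaled
  by a fixed factor.\<close>

lemma closed_left_ideal_cl:
  assumes S: "lc_subspace A S" and ideal: "\<And>a x. a \<in> C \<Longrightarrow> x \<in> S \<Longrightarrow> a \<otimes> x \<in> S"
  shows "closed_left_ideal A (cl S)"
proof -
  note SD = subspaceD[OF S]
  have SC: "S \<subseteq> C" using SD by blast
  have "x \<oplus> y \<in> cl S" if x: "x \<in> cl S" and y: "y \<in> cl S" for x y
  proof (rule clI)
    have C: "x \<in> C" "y \<in> C" using x y cl_subset_carrier by auto
    then show "x \<oplus> y \<in> C" by simp
    fix n and e :: real assume "0 < e"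
    then obtain u v where u: "u \<in> S" "q n (x \<ominus> u) < e / 2" and v: "v \<in> S" "q n (y \<ominus> v) < e / 2"
      using clE[OF x, of "e / 2" n] clE[OF y, of "e / 2" n] by (metis half_gt_zero)
    have "q n ((x \<oplus> y) \<ominus> (u \<oplus> v)) < e"
      using u v SD C triangle[of "x \<ominus> u" "y \<ominus> v" n] by (simp add: add_sub_add)
    then show "\<exists>w\<in>S. q n ((x \<oplus> y) \<ominus> w) < e" using SD(3) u v by blast
  qed
  moreover have "c \<odot> x \<in> cl S" if x: "x \<in> cl S" for c x
  proof (rule clI)
    have C: "x \<in> C" using x cl_subset_carrier by auto
    then show "c \<odot> x \<in> C" by simp
    fix n and e :: real assume "0 < e"
    then obtain d where d: "0 < d" "cmod c * d < e"
      using small_multiple by (metis norm_ge_zero)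
    then obtain u where u: "u \<in> S" "q n (x \<ominus> u) < d" using clE[OF x] by metis
    have "q n (c \<odot> x \<ominus> c \<odot> u) = cmod c * q n (x \<ominus> u)"
      using SD C u by (simp add: p_smult flip: smult_sub)
    also have "\<dots> \<le> cmod c * d" using u by (intro mult_left_mono) auto
    finally have "q n (c \<odot> x \<ominus> c \<odot> u) < e" using d by simp
    then show "\<exists>w\<in>S. q n (c \<odot> x \<ominus> w) < e" using SD(4) u by blast
  qed
  moreover have "a \<otimes> x \<in> cl S" if a: "a \<in> C" and x: "x \<in> cl S" for a x
  proof (rule clI)
    have C: "x \<in> C" using x cl_subset_carrier by auto
    then show "a \<otimes> x \<in> C" using a by simp
    fix n and e :: real assume "0 < e"
    then obtain d where d: "0 < d" "q n a * d < e"
      using small_multiple nonneg[OF a] by metis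
    then obtain u where u: "u \<in> S" "q n (x \<ominus> u) < d" using clE[OF x] by metis
    have "q n (a \<otimes> x \<ominus> a \<otimes> u) \<le> q n a * q n (x \<ominus> u)"
      using SD C u a p_mult[of a "x \<ominus> u" n] by (simp add: mult_sub)
    also have "\<dots> \<le> q n a * d" using u a by (intro mult_left_mono) auto
    finally have "q n (a \<otimes> x \<ominus> a \<otimes> u) < e" using d by simp
    then show "\<exists>w\<in>S. q n (a \<otimes> x \<ominus> w) < e" using ideal a u by blast
  qed
  ultimately show ?thesis
    unfolding closed_left_ideal_def closedin_iff
    using cl_subset_carrier[of S] cl_cl[OF SC] subset_cl[OF SC] SD(2)
    by (auto simp: lc_subspace_def)
qed

lemma continuous_map_mult:
  "continuous_map (prod_topology (lc_topology A) (lc_topology A)) (lc_topology A)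
     (\<lambda>(x, y). x \<otimes> y)"
  unfolding continuous_map_def
proof (intro conjI allI impI)
  fix U assume U: "openin (lc_topology A) U"
  let ?V = "{z \<in> topspace (prod_topology (lc_topology A) (lc_topology A)). (case z of (x, y) \<Rightarrow> x \<otimes> y) \<in> U}"
  show "openin (prod_topology (lc_topology A) (lc_topology A)) ?V"
    unfolding openin_prod_topology_alt
  proof (intro allI impI)
    fix x y assume "(x, y) \<in> ?V"
    then have xy: "x \<in> C" "y \<in> C" "x \<otimes> y \<in> U" by auto
    obtain n e where e: "0 < e" "{w \<in> C. q n (w \<ominus> x \<otimes> y) < e} \<subseteq> U"
      using U xy unfolding openin_iff by meson
    define r where "r = 1 + q n y + q n x"
    have r: "0 < r" using nonneg[OF xy(1), of n] nonneg[OF xy(2), of n] unfolding r_def by linarith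
    \<comment> \<open>The identity is \<open>u v - x y = (u - x) v + x (v - y)\<close>. Radius at
      most 1 bounds \<open>q n v\<close> by \<open>1 + q n y\<close>, so the total error is below
      \<open>d * r\<close>.\<close>
    define d where "d = min 1 (e / r)"
    have d: "0 < d" "d \<le> 1" "d * r \<le> e"
      using e r by (auto simp: d_def min_def field_simps)
    let ?B = "\<lambda>x. {w \<in> C. q n (w \<ominus> x) < d}"
    have "?B x \<times> ?B y \<subseteq> ?V"
    proof
      fix z assume "z \<in> ?B x \<times> ?B y"
      then obtain u v where z: "z = (u, v)"
        and u: "u \<in> C" "q n (u \<ominus> x) < d" and v: "v \<in> C" "q n (v \<ominus> y) < d"
        by blast
      have "u \<otimes> v \<ominus> x \<otimes> y = (u \<otimes> v \<ominus> x \<otimes> v) \<oplus> (x \<otimes> v \<ominus> x \<otimes> y)"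
        using u v xy by (simp add: sub_add_sub)
      also have "\<dots> = (u \<ominus> x) \<otimes> v \<oplus> x \<otimes> (v \<ominus> y)"
        using u v xy by (simp add: mult_sub sub_mult)
      finally have "q n (u \<otimes> v \<ominus> x \<otimes> y) \<le> q n (u \<ominus> x) * q n v + q n x * q n (v \<ominus> y)"
        using u v xy triangle[of "(u \<ominus> x) \<otimes> v" "x \<otimes> (v \<ominus> y)" n]
          p_mult[of "u \<ominus> x" v n] p_mult[of x "v \<ominus> y" n] by simp
      also have "\<dots> \<le> q n (u \<ominus> x) * (1 + q n y) + q n x * d"
      proof -
        have "q n v \<le> 1 + q n y"
          using triangle[of y "v \<ominus> y" n] v xy d by simp
        then show ?thesis using u v xy by (intro add_mono mult_left_mono) auto
      qed
      also have "\<dots> < d * (1 + q n y) + q n x * d"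
        using u(2) nonneg[OF xy(2), of n]
        by (intro add_strict_right_mono mult_strict_right_mono) auto
      also have "\<dots> \<le> e" using d(3) by (simp add: r_def algebra_simps)
      finally show "z \<in> ?V" using e(2) u v z by auto
    qed
    then show "\<exists>U V. openin (lc_topology A) U \<and> openin (lc_topology A) V \<and> x \<in> U \<and> y \<in> V \<and> U \<times> V \<subseteq> ?V"
      using openin_ball[of x n d] openin_ball[of y n d] xy d
      by (intro exI[of _ "?B x"] exI[of _ "?B y"]) auto
  qed
qed auto

text \<open>The involution exchanges closed left and closed right ideals.\<close>

lemma annihilator_algebraI:
  assumes left: "\<And>J. closed_left_ideal A J \<Longrightarrow> ran A J = {\<zero>} \<longleftrightarrow> J = C"
  shows "annihilator_algebra A"
  unfolding annihilator_algebra_def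
proof (intro conjI allI impI left)
  fix K assume K: "closed_right_ideal A K"
  then have sub: "lc_subspace A K" and KC: "K \<subseteq> C"
    by (auto simp: closed_right_ideal_def lc_subspace_def)
  note KD = subspaceD[OF sub]
  have mem: "x \<in> star ` K \<longleftrightarrow> star x \<in> K" if "x \<in> C" for x
  proof
    assume "star x \<in> K"
    then have "star (star x) \<in> star ` K" by (rule imageI)
    then show "x \<in> star ` K" using that by simp
  qed (use KD in auto)
  have J: "closed_left_ideal A (star ` K)"
    unfolding closed_left_ideal_def
  proof (intro conjI ballI)
    show "lc_subspace A (star ` K)"
      unfolding lc_subspace_def
    proof (intro conjI ballI allI)
      show "\<zero> \<in> star ` K" using KD(2) by (simp add: mem)
      show "c \<odot> x \<in> star ` K" if "x \<in> star ` K" for c x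
        using that KD by (auto simp: mem star_smult)
      show "x \<oplus> y \<in> star ` K" if "x \<in> star ` K" "y \<in> star ` K" for x y
        using that KD by (auto simp: mem star_add)
    qed (use KC in auto)
    show "a \<otimes> x \<in> star ` K" if "a \<in> C" "x \<in> star ` K" for a x
      using that KD K by (auto simp: mem star_mult closed_right_ideal_def)
    have "star x \<in> cl K" if cl: "x \<in> cl (star ` K)" for x
    proof (rule clI)
      have x: "x \<in> C" using cl cl_subset_carrier by auto
      then show "star x \<in> C" by simp
      fix n and e :: real assume "0 < e"
      then obtain y where y: "y \<in> K" "q n (x \<ominus> star y) < e"
        using clE[OF cl, of e n] by blast
      then have "q n (star x \<ominus> y) < e"
        using x KD p_star[of "x \<ominus> star y" n] by (simp add: star_sub)
      then show "\<exists>y\<in>K. q n (star x \<ominus> y) < e" using y by blast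
    qed
    moreover have "cl K \<subseteq> K" using K by (simp add: closed_right_ideal_def closedin_iff)
    ultimately have "cl (star ` K) \<subseteq> star ` K"
      using mem cl_subset_carrier by (meson subset_iff)
    then show "closedin (lc_topology A) (star ` K)"
      unfolding closedin_iff using KC by auto
  qed
  have "a \<in> lan A K \<longleftrightarrow> star a \<in> ran A (star ` K)" if a: "a \<in> C" for a
  proof -
    have "star s \<otimes> star a = \<zero> \<longleftrightarrow> a \<otimes> s = \<zero>" if "s \<in> K" for s
    proof -
      have s: "s \<in> C" using that KD by simp
      have "star s \<otimes> star a = star (a \<otimes> s)" using a s by (simp add: star_mult)
      then show ?thesis using a s by (metis mult_closed star_eq_zero_iff)
    qed
    then show ?thesis using a by (simp add: lan_def ran_def)
  qed
  then have lan_ran: "lan A K = {a \<in> C. star a \<in> ran A (star ` K)}"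
    by (auto simp: lan_def)
  have "lan A K = {\<zero>} \<longleftrightarrow> ran A (star ` K) = {\<zero>}"
  proof
    assume L: "lan A K = {\<zero>}"
    have "x = \<zero>" if x: "x \<in> ran A (star ` K)" for x
    proof -
      have "x \<in> C" using x by (simp add: ran_def)
      then have "star x \<in> lan A K" using x by (simp add: lan_ran)
      then show ?thesis using L \<open>x \<in> C\<close> star_star[of x] by auto
    qed
    moreover have "\<zero> \<in> ran A (star ` K)" using KC by (auto simp: ran_def)
    ultimately show "ran A (star ` K) = {\<zero>}" by blast
  next
    assume "ran A (star ` K) = {\<zero>}"
    then have "lan A K = {a \<in> C. star a = \<zero>}" by (simp add: lan_ran)
    then show "lan A K = {\<zero>}" by (auto cong: conj_cong)
  qed
  also have "\<dots> \<longleftrightarrow> star ` K = C" using left[OF J] .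
  also have "\<dots> \<longleftrightarrow> K = C"
  proof
    assume L: "star ` K = C"
    have "x \<in> K" if "x \<in> C" for x
      using mem[of "star x"] that L by simp
    then show "K = C" using KC by blast
  next
    assume "K = C"
    then show "star ` K = C" using mem KC by auto
  qed
  finally show "lan A K = {\<zero>} \<longleftrightarrow> K = C" .
qed

subsection \<open>Closed selfadjoint ideals and their annihilators\<close>

definition star_ideal :: "'a set \<Rightarrow> bool" where
  "star_ideal I \<longleftrightarrow> lc_subspace A I \<and> (\<forall>a\<in>C. \<forall>x\<in>I. a \<otimes> x \<in> I \<and> x \<otimes> a \<in> I) \<and>
     (\<forall>x\<in>I. star x \<in> I) \<and> cl I \<subseteq> I"

text \<open>The annihilator is taken on both sides so that it is again closed under multiplication
  from either side and under the involution; for a \<open>star_ideal\<close> the right annihilator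
  already lies in it.\<close>

definition perp :: "'a set \<Rightarrow> 'a set" where
  "perp S = {x \<in> C. \<forall>s\<in>S. s \<otimes> x = \<zero> \<and> x \<otimes> s = \<zero>}"

definition kern :: "nat \<Rightarrow> 'a set" where
  "kern n = {x \<in> C. q n x = 0}"

lemma star_idealD:
  assumes "star_ideal I"
  shows "x \<in> I \<Longrightarrow> x \<in> C" "\<zero> \<in> I" "x \<in> I \<Longrightarrow> y \<in> I \<Longrightarrow> x \<oplus> y \<in> I" "x \<in> I \<Longrightarrow> c \<odot> x \<in> I"
    "x \<in> I \<Longrightarrow> y \<in> I \<Longrightarrow> x \<ominus> y \<in> I" "a \<in> C \<Longrightarrow> x \<in> I \<Longrightarrow> a \<otimes> x \<in> I" "a \<in> C \<Longrightarrow> x \<in> I \<Longrightarrow> x \<otimes> a \<in> I"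
    "x \<in> I \<Longrightarrow> star x \<in> I" "cl I \<subseteq> I"
  using assms subspace_sub[of I x y] unfolding star_ideal_def lc_subspace_def by auto

lemma star_ideal_kern: "star_ideal (kern n)"
proof -
  have add: "q n (x \<oplus> y) = 0" if "x \<in> C" "y \<in> C" "q n x = 0" "q n y = 0" for x y
    using triangle[of x y n] that by simp
  have mult: "q n (x \<otimes> y) = 0" if "x \<in> C" "y \<in> C" "q n x = 0 \<or> q n y = 0" for x y
    using p_mult[of x y n] that by auto
  have "cl (kern n) \<subseteq> kern n"
  proof
    fix x assume x: "x \<in> cl (kern n)"
    then have xC: "x \<in> C" using cl_subset_carrier by auto
    have "q n x \<le> 0 + e" if e: "0 < e" for e
    proof -
      obtain y where y: "y \<in> kern n" "q n (x \<ominus> y) < e" using clE[OF x e, of n] by blast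
      then show ?thesis
        using triangle[of y "x \<ominus> y" n] xC by (simp add: kern_def)
    qed
    then have "q n x \<le> 0" by (rule field_le_epsilon)
    then show "x \<in> kern n" using xC by (simp add: kern_def)
  qed
  moreover have "lc_subspace A (kern n)"
    unfolding lc_subspace_def by (simp add: kern_def add p_smult subset_iff)
  moreover have "\<forall>a\<in>C. \<forall>x\<in>kern n. a \<otimes> x \<in> kern n \<and> x \<otimes> a \<in> kern n" "\<forall>x\<in>kern n. star x \<in> kern n"
    by (simp_all add: kern_def mult p_star)
  ultimately show ?thesis
    unfolding star_ideal_def by blast
qed

lemma star_ideal_Int:
  assumes "star_ideal I" "star_ideal J"
  shows "star_ideal (I \<inter> J)"
proof -
  have "cl (I \<inter> J) \<subseteq> cl I \<inter> cl J" unfolding cl_def by blast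
  then have "cl (I \<inter> J) \<subseteq> I \<inter> J" using star_idealD(9) assms by blast
  then show ?thesis
    using star_idealD[OF assms(1)] star_idealD[OF assms(2)]
    unfolding star_ideal_def lc_subspace_def by auto
qed

lemma perp_subset_carrier: "perp S \<subseteq> C"
  by (auto simp: perp_def)

lemma perpD:
  assumes "x \<in> perp S" "s \<in> S"
  shows "s \<otimes> x = \<zero>" "x \<otimes> s = \<zero>"
  using assms by (auto simp: perp_def)

lemma perp_commute:
  assumes "S \<subseteq> C" "T \<subseteq> C"
  shows "S \<subseteq> perp T \<longleftrightarrow> T \<subseteq> perp S"
  using assms unfolding perp_def by blast

text \<open>If \<open>y\<close> in \<open>perp S\<close> is close to \<open>x\<close>, then
  \<open>s x = s (x - y)\<close> is small in every seminorm, and likewise on the other side.\<close>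

lemma cl_perp:
  assumes "S \<subseteq> C"
  shows "cl (perp S) \<subseteq> perp S"
proof
  fix x assume x: "x \<in> cl (perp S)"
  then have xC: "x \<in> C" using cl_subset_carrier by auto
  have "s \<otimes> x = \<zero> \<and> x \<otimes> s = \<zero>" if s: "s \<in> S" for s
  proof -
    have sC: "s \<in> C" using s assms by auto
    have le: "q n (s \<otimes> x) \<le> 0 + e \<and> q n (x \<otimes> s) \<le> 0 + e" if "0 < e" for n e
    proof -
      obtain d where d: "0 < d" "q n s * d < e"
        using small_multiple[OF \<open>0 < e\<close> nonneg[OF sC, of n]] by metis
      obtain y where y: "y \<in> perp S" "q n (x \<ominus> y) < d" using clE[OF x d(1), of n] by blast
      have yC: "y \<in> C" using y perp_subset_carrier by auto
      have "s \<otimes> x = s \<otimes> (x \<ominus> y)" "x \<otimes> s = (x \<ominus> y) \<otimes> s"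
        using perpD[OF y(1) s] xC yC sC by (simp_all add: mult_sub sub_mult)
      then have "q n (s \<otimes> x) \<le> q n s * q n (x \<ominus> y)" "q n (x \<otimes> s) \<le> q n s * q n (x \<ominus> y)"
        using p_mult[of s "x \<ominus> y" n] p_mult[of "x \<ominus> y" s n] xC yC sC by (simp_all add: mult.commute)
      moreover have "q n s * q n (x \<ominus> y) \<le> q n s * d"
        using y(2) sC by (intro mult_left_mono) auto
      ultimately show ?thesis using d by linarith
    qed
    have "q n (s \<otimes> x) = 0 \<and> q n (x \<otimes> s) = 0" for n
    proof -
      have "q n (s \<otimes> x) \<le> 0" "q n (x \<otimes> s) \<le> 0"
        by (rule field_le_epsilon; use le in blast)+
      then show ?thesis using xC sC by simp
    qed
    then show ?thesis using xC sC by (intro conjI q_separating) auto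
  qed
  then show "x \<in> perp S" using xC by (simp add: perp_def)
qed

lemma star_ideal_perp:
  assumes "star_ideal I"
  shows "star_ideal (perp I)"
  unfolding star_ideal_def
proof (intro conjI ballI)
  note D = star_idealD[OF assms]
  have IC: "I \<subseteq> C" using D by auto
  show "lc_subspace A (perp I)"
    using D(1) unfolding lc_subspace_def by (simp add: perp_def mult_add add_mult subset_iff)
  fix x assume x: "x \<in> perp I"
  then have xC: "x \<in> C" using perp_subset_carrier by auto
  show "star x \<in> perp I"
  proof -
    have "s \<otimes> star x = \<zero> \<and> star x \<otimes> s = \<zero>" if s: "s \<in> I" for s
    proof -
      have "s \<otimes> star x = star (x \<otimes> star s)" "star x \<otimes> s = star (star s \<otimes> x)"
        using xC D s by (simp_all add: star_mult)
      then show ?thesis using perpD[OF x D(8)[OF s]] by simp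
    qed
    then show ?thesis using xC by (simp add: perp_def)
  qed
  fix a assume a: "a \<in> C"
  have "s \<otimes> (a \<otimes> x) = \<zero> \<and> (a \<otimes> x) \<otimes> s = \<zero> \<and> s \<otimes> (x \<otimes> a) = \<zero> \<and> (x \<otimes> a) \<otimes> s = \<zero>"
    if s: "s \<in> I" for s
  proof -
    have "s \<otimes> a \<in> I" "a \<otimes> s \<in> I" using a s D by auto
    then have "(s \<otimes> a) \<otimes> x = \<zero>" "x \<otimes> (a \<otimes> s) = \<zero>" using perpD[OF x] by auto
    moreover have "(s \<otimes> x) \<otimes> a = \<zero>" "a \<otimes> (x \<otimes> s) = \<zero>" using perpD[OF x s] a by auto
    ultimately show ?thesis using s D a xC by (simp add: mult_assoc)
  qed
  then show "a \<otimes> x \<in> perp I" "x \<otimes> a \<in> perp I" using a xC by (auto simp: perp_def)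
qed (use cl_perp star_idealD(1)[OF assms] in auto)

lemma star_ideal_Int_perp:
  assumes "star_ideal I" "x \<in> I" "x \<in> perp I"
  shows "x = \<zero>"
  using star_mult_eq_zero[of x] perpD(1)[OF assms(3), of "star x"] star_idealD[OF assms(1)] assms(2)
  by simp

text \<open>For \<open>s\<close> in \<open>I\<close> the element \<open>star (a s)\<close> belongs
  to \<open>I\<close>, hence annihilates \<open>a\<close> from the left. So
  \<open>star (a s) (a s) = 0\<close>, and definiteness gives \<open>a s = 0\<close>.\<close>

lemma star_ideal_ran_subset_perp:
  assumes I: "star_ideal I"
  shows "ran A I \<subseteq> perp I"
proof
  note D = star_idealD[OF I]
  fix a assume "a \<in> ran A I"
  then have aC: "a \<in> C" and a: "\<And>s. s \<in> I \<Longrightarrow> s \<otimes> a = \<zero>" by (auto simp: ran_def)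
  have "a \<otimes> s = \<zero>" if s: "s \<in> I" for s
  proof -
    have "star (a \<otimes> s) \<in> I" using D aC s by simp
    then have "star (a \<otimes> s) \<otimes> (a \<otimes> s) = \<zero>"
      using a mult_assoc[of "star (a \<otimes> s)" a s] D(1) aC s by simp
    then show ?thesis using star_mult_eq_zero[of "a \<otimes> s"] D(1) aC s by simp
  qed
  then show "a \<in> perp I" using a aC by (simp add: perp_def)
qed

lemma perp_orthogonal_le:
  assumes "star_ideal I" "a \<in> I" "b \<in> perp I"
  shows "q n a \<le> q n (a \<oplus> b)"
  using assms star_idealD(1,8)[OF assms(1)] perpD(1)[OF assms(3), of "star a"]
    perp_subset_carrier[of I]
  by (intro p_orthogonal_le) auto

end

section \<open>Complementation of ideals from the annihilator condition and completeness\<close>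

locale annihilator_star_alg = star_alg_seq +
  assumes complete: "lc_complete A" and annihilator: "annihilator_algebra A"
begin

text \<open>Completeness is stated for Cauchy filters; a sequence enters as the image of the filter
  \<open>sequentially\<close>.\<close>

lemma Cauchy_limit:
  assumes s: "\<And>k. s k \<in> C"
    and Cauchy: "\<And>m e. 0 < e \<Longrightarrow> \<exists>N. \<forall>k\<ge>N. \<forall>l\<ge>N. q m (s k \<ominus> s l) < e"
  obtains a where "a \<in> C" "\<And>m e. 0 < e \<Longrightarrow> \<forall>\<^sub>F k in sequentially. q m (s k \<ominus> a) < e"
proof -
  let ?F = "filtermap s sequentially"
  have "\<forall>\<^sub>F (x, y) in ?F \<times>\<^sub>F ?F. q m (x \<ominus> y) < e" if e: "0 < e" for m e
  proof -
    obtain N where N: "\<forall>k\<ge>N. \<forall>l\<ge>N. q m (s k \<ominus> s l) < e" using Cauchy[OF e] by blast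
    have ev: "\<forall>\<^sub>F x in ?F. x \<in> s ` {N..}"
      unfolding eventually_filtermap
      using eventually_ge_at_top[of N] by eventually_elim auto
    show ?thesis
      unfolding eventually_prod_filter
      using N by (intro exI[of _ "\<lambda>x. x \<in> s ` {N..}"] conjI ev) auto
  qed
  moreover have "?F \<noteq> bot" by (simp add: filtermap_bot_iff)
  moreover have "\<forall>\<^sub>F x in ?F. x \<in> C" using s by (simp add: eventually_filtermap)
  ultimately obtain a where "a \<in> C" "\<forall>p\<in>range q. \<forall>e>0. \<forall>\<^sub>F x in ?F. p (x \<ominus> a) < e"
    using complete unfolding lc_complete_def seminorms by blast
  then show thesis by (intro that[of a]) (auto simp: eventually_filtermap)
qed

text \<open>Serves twice as a source of a nonzero \<open>z\<close>: for the sum of an ideal and its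
  complement, and for the left ideal of all \<open>b - c b y\<close>.\<close>

lemma proper_left_ideal_annihilated:
  assumes S: "lc_subspace A S" and ideal: "\<And>a x. a \<in> C \<Longrightarrow> x \<in> S \<Longrightarrow> a \<otimes> x \<in> S"
    and proper: "cl S \<noteq> C"
  obtains z where "z \<in> C" "z \<noteq> \<zero>" "\<And>s. s \<in> S \<Longrightarrow> s \<otimes> z = \<zero>"
proof -
  have SC: "S \<subseteq> C" using subspaceD[OF S] by auto
  have "ran A (cl S) \<noteq> {\<zero>}"
    using annihilator closed_left_ideal_cl[OF S ideal] proper
    unfolding annihilator_algebra_def by blast
  moreover have "\<zero> \<in> ran A (cl S)"
    using cl_subset_carrier[of S] by (auto simp: ran_def)
  ultimately obtain z where "z \<in> ran A (cl S)" "z \<noteq> \<zero>" by blast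
  then show thesis
    using that[of z] subset_cl[OF SC] by (auto simp: ran_def)
qed

text \<open>Otherwise a nonzero \<open>z\<close> is annihilated by the sum. Being annihilated by
  \<open>I\<close> puts \<open>z\<close>, and so \<open>star z\<close>, into \<open>perp I\<close>,
  which is part of the sum; thus \<open>star z\<close> annihilates \<open>z\<close>.\<close>

lemma star_ideal_add_perp_dense:
  assumes I: "star_ideal I"
  shows "cl {a \<oplus> b |a b. a \<in> I \<and> b \<in> perp I} = C" (is "cl ?S = C")
proof (rule ccontr)
  assume proper: "cl ?S \<noteq> C"
  note D = star_idealD[OF I] and D' = star_idealD[OF star_ideal_perp[OF I]]
  have mem: "a \<oplus> b \<in> ?S" if "a \<in> I" "b \<in> perp I" for a b
    using that by blast
  have S: "lc_subspace A ?S"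
    unfolding lc_subspace_def
  proof (intro conjI ballI allI)
    show "?S \<subseteq> C" using D(1) D'(1) by auto
    show "\<zero> \<in> ?S" using mem[OF D(2) D'(2)] by simp
    fix x assume "x \<in> ?S"
    then obtain a b where x: "x = a \<oplus> b" "a \<in> I" "b \<in> perp I" by blast
    show "c \<odot> x \<in> ?S" for c
      using mem[of "c \<odot> a" "c \<odot> b"] x D D' by (simp add: smult_add)
    fix y assume "y \<in> ?S"
    then obtain u v where y: "y = u \<oplus> v" "u \<in> I" "v \<in> perp I" by blast
    have "x \<oplus> y = (a \<oplus> u) \<oplus> (b \<oplus> v)"
      using x y D(1) D'(1) by (simp add: add_ac)
    then show "x \<oplus> y \<in> ?S" using mem[of "a \<oplus> u" "b \<oplus> v"] x y D D' by simp
  qed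
  have ideal: "c \<otimes> x \<in> ?S" if c: "c \<in> C" and "x \<in> ?S" for c x
  proof -
    from \<open>x \<in> ?S\<close> obtain a b where x: "x = a \<oplus> b" "a \<in> I" "b \<in> perp I" by blast
    then show ?thesis using mem[of "c \<otimes> a" "c \<otimes> b"] c D D' by (simp add: mult_add)
  qed
  obtain z where z: "z \<in> C" "z \<noteq> \<zero>" "\<And>s. s \<in> ?S \<Longrightarrow> s \<otimes> z = \<zero>"
    using proper_left_ideal_annihilated[OF S ideal proper] by blast
  have "a \<otimes> z = \<zero>" if "a \<in> I" for a
    using z(3)[OF mem[OF that D'(2)]] D(1)[OF that] by simp
  then have "z \<in> perp I"
    using star_ideal_ran_subset_perp[OF I] z(1) by (auto simp: ran_def)
  then have "star z \<in> ?S" using mem[OF D(2), of "star z"] D' by simp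
  then have "star z \<otimes> z = \<zero>" by (rule z(3))
  then show False using star_mult_eq_zero z by blast
qed

lemma star_ideal_decomposition:
  assumes I: "star_ideal I" and x: "x \<in> C"
  obtains a where "a \<in> I" "x \<ominus> a \<in> perp I"
proof -
  note D = star_idealD[OF I] and D' = star_idealD[OF star_ideal_perp[OF I]]
  \<comment> \<open>Index and precision are coupled diagonally, so that monotonicity gives
    convergence for every seminorm.\<close>
  have "\<exists>a b. a \<in> I \<and> b \<in> perp I \<and> q k (x \<ominus> (a \<oplus> b)) < 1 / real (Suc k)" for k
    using clE[of x _ "1 / real (Suc k)" k] star_ideal_add_perp_dense[OF I] x
    by (smt (verit) mem_Collect_eq of_nat_0_less_iff zero_less_Suc zero_less_divide_1_iff)
  then obtain a b where a: "\<And>k. a k \<in> I" and b: "\<And>k. b k \<in> perp I"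
    and ab: "\<And>k. q k (x \<ominus> (a k \<oplus> b k)) < 1 / real (Suc k)"
    by metis
  have aC [simp]: "a k \<in> C" and bC [simp]: "b k \<in> C" for k using a b D(1) D'(1) by auto
  have small: "\<exists>N. \<forall>k\<ge>N. q m (x \<ominus> (a k \<oplus> b k)) < e" if "0 < e" for m e
  proof -
    obtain M where M: "1 / real (Suc M) < e" using nat_approx_posE[OF \<open>0 < e\<close>] by metis
    have "q m (x \<ominus> (a k \<oplus> b k)) < e" if k: "k \<ge> max m M" for k
    proof -
      have "q m (x \<ominus> (a k \<oplus> b k)) \<le> q k (x \<ominus> (a k \<oplus> b k))"
        using k x by (intro q_mono) auto
      also have "\<dots> < 1 / real (Suc k)" by (rule ab)
      also have "\<dots> \<le> 1 / real (Suc M)" using k by (simp add: field_simps)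
      finally show ?thesis using M by simp
    qed
    then show ?thesis by blast
  qed
  have "\<exists>N. \<forall>k\<ge>N. \<forall>l\<ge>N. q m (a k \<ominus> a l) < e" if e: "0 < e" for m e
  proof -
    obtain N where N: "\<forall>k\<ge>N. q m (x \<ominus> (a k \<oplus> b k)) < e / 2"
      using small[of "e / 2" m] e by auto
    have "q m (a k \<ominus> a l) < e" if "k \<ge> N" "l \<ge> N" for k l
    proof -
      \<comment> \<open>Orthogonality allows the \<open>perp I\<close> part to be added on the
        right, leaving a difference of two approximations of \<open>x\<close>.\<close>
      have "q m (a k \<ominus> a l) \<le> q m ((a k \<ominus> a l) \<oplus> (b k \<ominus> b l))"
        using a b D D' by (intro perp_orthogonal_le[OF I]) auto
      also have "\<dots> = q m ((a k \<oplus> b k) \<ominus> (a l \<oplus> b l))"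
        by (simp add: add_sub_add)
      also have "\<dots> \<le> q m (x \<ominus> (a k \<oplus> b k)) + q m (x \<ominus> (a l \<oplus> b l))"
        using p_sub_triangle[of "a k \<oplus> b k" x "a l \<oplus> b l" m] p_sub_commute[of x "a k \<oplus> b k" m] x
        by simp
      also have "\<dots> < e" using N[rule_format, of k] N[rule_format, of l] that by linarith
      finally show ?thesis .
    qed
    then show ?thesis by blast
  qed
  then obtain u where u: "u \<in> C" "\<And>m e. 0 < e \<Longrightarrow> \<forall>\<^sub>F k in sequentially. q m (a k \<ominus> u) < e"
    using Cauchy_limit[of a] aC by blast
  have "u \<in> cl I"
  proof (rule clI[OF u(1)])
    fix n and e :: real assume "0 < e"
    then obtain k where "q n (a k \<ominus> u) < e"
      using eventually_happens'[OF sequentially_bot u(2), of e n] by blast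
    then show "\<exists>y\<in>I. q n (u \<ominus> y) < e"
      using a p_sub_commute[OF u(1) aC] by metis
  qed
  \<comment> \<open>The elements \<open>b k\<close> approximate \<open>x - u\<close>: the error is
    \<open>(x - (a k + b k)) + (a k - u)\<close>.\<close>
  moreover have "x \<ominus> u \<in> cl (perp I)"
  proof (rule clI)
    fix n and e :: real assume e: "0 < e"
    obtain N where N: "\<forall>k\<ge>N. q n (x \<ominus> (a k \<oplus> b k)) < e / 2"
      using small[of "e / 2" n] e by auto
    have "\<forall>\<^sub>F k in sequentially. q n (a k \<ominus> u) < e / 2 \<and> k \<ge> N"
      using u(2)[of "e / 2" n] e eventually_ge_at_top by (intro eventually_conj) auto
    then obtain k where k: "q n (a k \<ominus> u) < e / 2" "k \<ge> N"
      using eventually_happens'[OF sequentially_bot] by blast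
    have "(x \<ominus> u) \<ominus> b k = (x \<ominus> b k) \<ominus> u" "x \<ominus> (a k \<oplus> b k) = (x \<ominus> b k) \<ominus> a k"
      using x u(1) by (simp_all add: lc_sub_def smult_add add_ac)
    then have "(x \<ominus> u) \<ominus> b k = (x \<ominus> (a k \<oplus> b k)) \<oplus> (a k \<ominus> u)"
      using x u(1) by (simp add: sub_add_sub)
    then have "q n ((x \<ominus> u) \<ominus> b k) < e"
      using triangle[of "x \<ominus> (a k \<oplus> b k)" "a k \<ominus> u" n] N k x u(1) by fastforce
    then show "\<exists>y\<in>perp I. q n ((x \<ominus> u) \<ominus> y) < e" using b by blast
  qed (use x u in simp)
  ultimately show thesis using that D(9) D'(9) by blast
qed

text \<open>
  The seminorm \<open>q n\<close> is a norm on the complement of its kernel, and there it dominates all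
  other seminorms. If not, scale \<open>x* x\<close> to get \<open>y\<close> with \<open>q n y < 1 = q m y\<close>; the annihilator
  condition turns the spectral value of \<open>y\<close> into an eigenvector \<open>z = c y z\<close>, whence
  \<open>q n z = 0\<close>.
\<close>

lemma q_le_on_perp_kern:
  assumes x: "x \<in> perp (kern n)"
  shows "q m x \<le> q n x"
proof (rule ccontr)
  assume "\<not> q m x \<le> q n x"
  then have less: "q n x < q m x" by simp
  note D = star_idealD[OF star_ideal_perp[OF star_ideal_kern[of n]]]
  have xC: "x \<in> C" using x D by auto
  define r where "r = 1 / (q m x)\<^sup>2"
  define y where "y = complex_of_real r \<odot> (star x \<otimes> x)"
  have pos: "0 < q m x" using less nonneg[OF xC, of n] by linarith
  then have r: "0 < r" by (simp add: r_def)
  have y: "y \<in> perp (kern n)" using x xC D by (simp add: y_def)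
  then have yC: "y \<in> C" using D by auto
  have ystar: "star y = y" using xC by (simp add: y_def star_smult star_mult)
  have q_y: "q k y = (q k x)\<^sup>2 / (q m x)\<^sup>2" for k
    using xC r by (simp add: y_def p_smult p_star_mult) (simp add: r_def)
  have y1: "q m y = 1" using pos by (simp add: q_y)
  have "(q n x)\<^sup>2 < (q m x)\<^sup>2"
    using less nonneg[OF xC, of n] by (intro power_strict_mono) auto
  then have y2: "q n y < 1" using pos by (simp add: q_y)
  obtain c where c: "\<And>b. b \<in> C \<Longrightarrow> 1 / 2 \<le> q m ((b \<ominus> c \<odot> (b \<otimes> y)) \<ominus> c \<odot> y)"
    and c1: "cmod c = 1"
    using selfadjoint_spectral_value[OF yC ystar y1] by blast
  \<comment> \<open>This is \<open>A (1 - c y)\<close> written without a unit. The choice of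
    \<open>c\<close> keeps \<open>c y\<close> at \<open>q m\<close>-distance at least 1/2 from it,
    so it is not dense.\<close>
  let ?S = "(\<lambda>b. b \<ominus> c \<odot> (b \<otimes> y)) ` C"
  have S: "lc_subspace A ?S"
    unfolding lc_subspace_def
  proof (intro conjI ballI allI)
    show "?S \<subseteq> C" using yC by auto
    show "\<zero> \<in> ?S" using yC by (intro image_eqI[of _ _ "\<zero>"]) auto
    fix u assume "u \<in> ?S"
    then obtain a where a: "a \<in> C" "u = a \<ominus> c \<odot> (a \<otimes> y)" by blast
    show "d \<odot> u \<in> ?S" for d
      using a yC by (intro image_eqI[of _ _ "d \<odot> a"]) (auto simp: smult_sub mult.commute)
    fix v assume "v \<in> ?S"
    then obtain b where b: "b \<in> C" "v = b \<ominus> c \<odot> (b \<otimes> y)" by blast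
    show "u \<oplus> v \<in> ?S"
      using a b yC by (intro image_eqI[of _ _ "a \<oplus> b"]) (auto simp: add_mult smult_add add_sub_add)
  qed
  have ideal: "a \<otimes> u \<in> ?S" if a: "a \<in> C" and "u \<in> ?S" for a u
  proof -
    from \<open>u \<in> ?S\<close> obtain b where "b \<in> C" "u = b \<ominus> c \<odot> (b \<otimes> y)" by blast
    then show ?thesis
      using a yC by (intro image_eqI[of _ _ "a \<otimes> b"]) (auto simp: mult_sub mult_assoc)
  qed
  have "c \<odot> y \<notin> cl ?S"
  proof
    assume "c \<odot> y \<in> cl ?S"
    then obtain u where "u \<in> ?S" "q m (c \<odot> y \<ominus> u) < 1 / 2"
      using clE[of "c \<odot> y" ?S "1 / 2" m] by auto
    then obtain b where b: "b \<in> C" "q m (c \<odot> y \<ominus> (b \<ominus> c \<odot> (b \<otimes> y))) < 1 / 2" by blast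
    then show False
      using c[OF b(1)] p_sub_commute[of "c \<odot> y" "b \<ominus> c \<odot> (b \<otimes> y)" m] yC by simp
  qed
  then have "cl ?S \<noteq> C" using yC by auto
  then obtain z where z: "z \<in> C" "z \<noteq> \<zero>" "\<And>s. s \<in> ?S \<Longrightarrow> s \<otimes> z = \<zero>"
    using proper_left_ideal_annihilated[OF S ideal] by blast
  \<comment> \<open>Any \<open>v\<close> satisfies \<open>v w = (v - c v y) z = 0\<close>; taking
    \<open>v = star w\<close> forces \<open>w = 0\<close>.\<close>
  define w where "w = z \<ominus> c \<odot> (y \<otimes> z)"
  have wC: "w \<in> C" using z yC by (simp add: w_def)
  have "v \<otimes> w = (v \<ominus> c \<odot> (v \<otimes> y)) \<otimes> z" if "v \<in> C" for v
    using z(1) yC that by (simp add: w_def mult_sub sub_mult mult_assoc)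
  then have "star w \<otimes> w = \<zero>" using z(3) wC by simp
  then have "w = \<zero>" by (rule star_mult_eq_zero[OF wC])
  then have zz: "z = c \<odot> (y \<otimes> z)" using sub_eq_zero_iff z(1) yC by (simp add: w_def)
  have "z \<in> perp (kern n)" using D y z(1) yC by (subst zz) auto
  moreover have "z \<in> kern n"
  proof -
    have "q n z = q n (y \<otimes> z)"
      using z(1) yC c1 by (subst zz) (simp add: p_smult)
    also have "\<dots> \<le> q n y * q n z" using p_mult z(1) yC by simp
    finally have "(1 - q n y) * q n z \<le> 0" by (simp add: algebra_simps)
    then have "q n z \<le> 0" using y2 by (simp add: mult_le_0_iff)
    then show ?thesis using z(1) nonneg[OF z(1), of n] by (simp add: kern_def)
  qed
  ultimately show False
    using star_ideal_Int_perp[OF star_ideal_kern] z(2) by blast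
qed

end

context star_alg
begin

lemma star_algebra_subalgebra:
  assumes S: "lc_subspace A S"
    and "\<And>x y. x \<in> S \<Longrightarrow> y \<in> S \<Longrightarrow> x \<otimes> y \<in> S" "\<And>x. x \<in> S \<Longrightarrow> star x \<in> S"
  shows "star_algebra (A\<lparr>lc_carrier := S, lc_seminorms := P\<rparr>)"
proof -
  have [simp]: "x \<in> C" if "x \<in> S" for x using that subspaceD[OF S] by blast
  show ?thesis
    using subspaceD(2-4)[OF S] assms(2,3)
    unfolding star_algebra_def Let_def
    by (simp add: add_ac smult_add add_smult mult_assoc mult_add add_mult
        star_add star_smult star_mult)
qed

primrec psum :: "(nat \<Rightarrow> 'a) \<Rightarrow> nat \<Rightarrow> 'a" where
  "psum b 0 = \<zero>"
| "psum b (Suc k) = psum b k \<oplus> b k"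

lemma psum_closed [simp]: "(\<And>i. b i \<in> C) \<Longrightarrow> psum b k \<in> C"
  by (induction k) auto

end

section \<open>The projection onto a closed selfadjoint ideal\<close>

locale annihilator_star_alg0 = annihilator_star_alg +
  assumes q_0: "x \<in> C \<Longrightarrow> q 0 x = 0"
begin

definition proj :: "'a set \<Rightarrow> 'a \<Rightarrow> 'a" where
  "proj I x = (THE a. a \<in> I \<and> x \<ominus> a \<in> perp I)"

text \<open>Two candidates differ by an element of both \<open>I\<close> and \<open>perp I\<close>.
  All algebraic properties of \<open>proj\<close> follow by exhibiting a decomposition and appealing
  to uniqueness.\<close>

lemma proj_unique:
  assumes I: "star_ideal I" and x: "x \<in> C" and a: "a \<in> I" "x \<ominus> a \<in> perp I"
  shows "proj I x = a"
  unfolding proj_def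
proof (rule the_equality)
  fix b assume b: "b \<in> I \<and> x \<ominus> b \<in> perp I"
  note D = star_idealD[OF I] and D' = star_idealD[OF star_ideal_perp[OF I]]
  have "a \<in> C" "b \<in> C" using a b D by auto
  then have "(x \<ominus> a) \<ominus> (x \<ominus> b) = b \<ominus> a"
    using x by (simp add: sub_sub_sub)
  then have "b \<ominus> a \<in> perp I" using a b D'(5) by metis
  then have "b \<ominus> a = \<zero>" using star_ideal_Int_perp[OF I] a b D(5) by blast
  then show "b = a" using sub_eq_zero_iff \<open>a \<in> C\<close> \<open>b \<in> C\<close> by blast
qed (use a in blast)

lemma
  assumes "star_ideal I" "x \<in> C"
  shows proj_in: "proj I x \<in> I" and proj_perp: "x \<ominus> proj I x \<in> perp I"
  using star_ideal_decomposition[OF assms] proj_unique[OF assms] by metis+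

lemma proj_closed: "star_ideal I \<Longrightarrow> x \<in> C \<Longrightarrow> proj I x \<in> C"
  using proj_in star_idealD(1) by blast

lemma proj_add:
  assumes I: "star_ideal I" and x: "x \<in> C" and y: "y \<in> C"
  shows "proj I (x \<oplus> y) = proj I x \<oplus> proj I y"
proof (rule proj_unique[OF I])
  note D = star_idealD[OF I] and D' = star_idealD[OF star_ideal_perp[OF I]]
  show "(x \<oplus> y) \<ominus> (proj I x \<oplus> proj I y) \<in> perp I"
    using D'(3)[OF proj_perp[OF I x] proj_perp[OF I y]] x y proj_closed[OF I] by (simp add: add_sub_add)
qed (use x y proj_in[OF I] star_idealD[OF I] in auto)

lemma proj_smult:
  assumes I: "star_ideal I" and x: "x \<in> C"
  shows "proj I (c \<odot> x) = c \<odot> proj I x"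
proof (rule proj_unique[OF I])
  note D' = star_idealD[OF star_ideal_perp[OF I]]
  show "c \<odot> x \<ominus> c \<odot> proj I x \<in> perp I"
    using D'(4)[OF proj_perp[OF I x]] x proj_closed[OF I x] by (simp add: smult_sub)
qed (use x proj_in[OF I] star_idealD[OF I] in auto)

lemma proj_sub:
  assumes I: "star_ideal I" and x: "x \<in> C" and y: "y \<in> C"
  shows "proj I (x \<ominus> y) = proj I x \<ominus> proj I y"
  using proj_add[OF I x, of "(-1) \<odot> y"] proj_smult[OF I y] y by (simp add: lc_sub_def)

lemma proj_star:
  assumes I: "star_ideal I" and x: "x \<in> C"
  shows "proj I (star x) = star (proj I x)"
proof (rule proj_unique[OF I])
  note D' = star_idealD[OF star_ideal_perp[OF I]]
  show "star x \<ominus> star (proj I x) \<in> perp I"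
    using D'(8)[OF proj_perp[OF I x]] x proj_closed[OF I x] by (simp add: star_sub)
qed (use x proj_in[OF I] star_idealD[OF I] in auto)

text \<open>Writing \<open>P\<close> for \<open>proj I\<close>,
  \<open>x y - P x P y = (x - P x) y + P x (y - P y)\<close>, and \<open>perp I\<close> is a
  two-sided ideal.\<close>

lemma proj_mult:
  assumes I: "star_ideal I" and x: "x \<in> C" and y: "y \<in> C"
  shows "proj I (x \<otimes> y) = proj I x \<otimes> proj I y"
proof (rule proj_unique[OF I])
  note D' = star_idealD[OF star_ideal_perp[OF I]]
  have [simp]: "proj I x \<in> C" "proj I y \<in> C" using proj_closed I x y by auto
  have "x \<otimes> y \<ominus> proj I x \<otimes> proj I y
      = (x \<otimes> y \<ominus> proj I x \<otimes> y) \<oplus> (proj I x \<otimes> y \<ominus> proj I x \<otimes> proj I y)"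
    using x y by (simp add: sub_add_sub)
  also have "\<dots> = (x \<ominus> proj I x) \<otimes> y \<oplus> proj I x \<otimes> (y \<ominus> proj I y)"
    using x y by (simp add: mult_sub sub_mult)
  also have "\<dots> \<in> perp I"
    using proj_perp[OF I x] proj_perp[OF I y] x y D' by simp
  finally show "x \<otimes> y \<ominus> proj I x \<otimes> proj I y \<in> perp I" .
  show "proj I x \<otimes> proj I y \<in> I"
    using star_idealD(6)[OF I _ proj_in[OF I y]] by simp
qed (use x y in simp)

lemma proj_id: "star_ideal I \<Longrightarrow> x \<in> I \<Longrightarrow> proj I x = x"
  using proj_unique[of I x x] star_idealD[of I] star_idealD(2)[OF star_ideal_perp[of I]] by simp

lemma proj_perp_eq_zero: "star_ideal I \<Longrightarrow> x \<in> perp I \<Longrightarrow> proj I x = \<zero>"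
  using proj_unique[of I x "\<zero>"] star_idealD(2)[of I] perp_subset_carrier[of I] by auto

lemma q_proj_le:
  assumes I: "star_ideal I" and x: "x \<in> C"
  shows "q n (proj I x) \<le> q n x"
  using perp_orthogonal_le[OF I proj_in[OF I x] proj_perp[OF I x], of n] proj_closed[OF I x] x
  by simp

subsection \<open>The summands\<close>

text \<open>The successive differences of the decreasing chain of kernels: \<open>block n\<close>
  complements \<open>kern (Suc n)\<close> inside \<open>kern n\<close>.\<close>

definition block :: "nat \<Rightarrow> 'a set" where
  "block n = kern n \<inter> perp (kern (Suc n))"

lemma star_ideal_block [simp]: "star_ideal (block n)"
  unfolding block_def by (intro star_ideal_Int star_ideal_perp star_ideal_kern)

lemma block_closed: "x \<in> block n \<Longrightarrow> x \<in> C"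
  by (simp add: block_def kern_def)

lemma kern_antimono:
  assumes "m \<le> n" shows "kern n \<subseteq> kern m"
proof
  fix x assume "x \<in> kern n"
  then have "x \<in> C" "q m x \<le> 0" using q_mono[OF assms, of x] by (auto simp: kern_def)
  then show "x \<in> kern m" by (simp add: kern_def)
qed

lemma kern_Suc_subset_perp_block: "kern (Suc n) \<subseteq> perp (block n)"
  using perp_commute[of "block n" "kern (Suc n)"] by (auto simp: block_def kern_def)

text \<open>For \<open>k < l\<close>, \<open>block l\<close> lies in \<open>kern l\<close>, hence in
  \<open>kern (Suc k)\<close>, which annihilates \<open>block k\<close>. The other order follows by
  symmetry of annihilation.\<close>

lemma block_orthogonal:
  assumes "i \<noteq> j" shows "block i \<subseteq> perp (block j)"
proof -
  have less: "block l \<subseteq> perp (block k)" if "k < l" for k l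
    using that kern_antimono[of "Suc k" l] kern_Suc_subset_perp_block[of k] by (auto simp: block_def)
  show ?thesis
  proof (cases "j < i")
    case False
    then have "block j \<subseteq> perp (block i)" using less[of i j] assms by simp
    moreover have "block i \<subseteq> C" "block j \<subseteq> C" using block_closed by auto
    ultimately show ?thesis using perp_commute by blast
  qed (rule less)
qed

lemma q_block_le: "x \<in> block n \<Longrightarrow> q m x \<le> q (Suc n) x"
  using q_le_on_perp_kern[of x "Suc n" m] by (simp add: block_def)

text \<open>One step down the chain. Split \<open>x = a + (x - a)\<close> along
  \<open>kern (Suc n)\<close>; since \<open>a\<close> also lies in \<open>kern n\<close>, so does
  \<open>x - a\<close>, which is therefore the \<open>block n\<close> component of
  \<open>x\<close>.\<close>

lemma sub_proj_block_kern:
  assumes x: "x \<in> kern n"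
  shows "x \<ominus> proj (block n) x \<in> kern (Suc n)"
proof -
  note D = star_idealD[OF star_ideal_kern]
  have xC: "x \<in> C" using x D(1) by blast
  obtain a where a: "a \<in> kern (Suc n)" "x \<ominus> a \<in> perp (kern (Suc n))"
    using star_ideal_decomposition[OF star_ideal_kern xC] by blast
  have aC: "a \<in> C" using a D(1) by blast
  have "a \<in> kern n" using a kern_antimono[of n "Suc n"] by auto
  then have b: "x \<ominus> a \<in> block n" using D(5) x a by (simp add: block_def)
  have xb: "x \<ominus> (x \<ominus> a) = a" using xC aC by (simp add: sub_sub_cancel)
  then have "proj (block n) x = x \<ominus> a"
    using a kern_Suc_subset_perp_block by (intro proj_unique[OF star_ideal_block xC b]) auto
  then show ?thesis using a xb by simp
qed

lemma q_psum_le: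
  assumes b: "\<And>i. b i \<in> block i"
  shows "q m (psum b k) \<le> (\<Sum>i<k. q (Suc i) (b i))"
proof (induction k)
  case (Suc k)
  have bC: "b i \<in> C" for i using b block_closed by blast
  show ?case
    using triangle[of "psum b k" "b k" m] Suc q_block_le[OF b, of m k] bC by simp
qed simp

text \<open>Terms with index at least \<open>k\<close> lie in \<open>kern k\<close>, so
  \<open>q k\<close> cannot tell later partial sums from the one at \<open>k\<close>.\<close>

lemma psum_sub_psum_kern:
  assumes b: "\<And>i. b i \<in> block i" and "k \<le> l"
  shows "psum b l \<ominus> psum b k \<in> kern k"
proof -
  have bC: "b i \<in> C" for i using b block_closed by blast
  show ?thesis using assms(2)
  proof (induction l rule: dec_induct)
    case base
    show ?case using bC by (simp add: star_idealD(2)[OF star_ideal_kern])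
  next
    case (step l)
    have "psum b (Suc l) \<ominus> psum b k = (psum b l \<ominus> psum b k) \<oplus> b l"
      using bC by (simp add: lc_sub_def add_ac)
    moreover have "b l \<in> kern k"
      using b[of l] kern_antimono step by (auto simp: block_def)
    ultimately show ?case using step star_idealD(3)[OF star_ideal_kern] by simp
  qed
qed

lemma proj_psum:
  assumes b: "\<And>i. b i \<in> block i"
  shows "proj (block i) (psum b k) = (if i < k then b i else \<zero>)"
proof (induction k)
  case 0
  show ?case using proj_perp_eq_zero[of "block i" "\<zero>"] star_idealD(2)[OF star_ideal_perp] by simp
next
  case (Suc k)
  have bC: "b i \<in> C" for i using b block_closed by blast
  have "proj (block i) (b k) = (if i = k then b k else \<zero>)"
    using proj_id[OF star_ideal_block b] proj_perp_eq_zero[OF star_ideal_block, of "b k" i]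
      block_orthogonal[of k i] b[of k] by auto
  then show ?case using Suc bC by (auto simp: proj_add)
qed

lemma sub_psum_proj_kern:
  assumes x: "x \<in> C"
  shows "x \<ominus> psum (\<lambda>i. proj (block i) x) k \<in> kern k"
proof (induction k)
  case 0
  \<comment> \<open>The place where \<open>q 0 = 0\<close> enters: the chain of kernels begins with
    the whole algebra.\<close>
  show ?case using x by (simp add: kern_def q_0)
next
  case (Suc k)
  let ?b = "\<lambda>i. proj (block i) x"
  have b: "?b i \<in> block i" "?b i \<in> C" for i using proj_in proj_closed x by auto
  have "proj (block k) (x \<ominus> psum ?b k) = ?b k"
    using proj_psum[of ?b k k] b x by (simp add: proj_sub)
  then have "(x \<ominus> psum ?b k) \<ominus> ?b k \<in> kern (Suc k)"
    using sub_proj_block_kern[OF Suc] by simp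
  moreover have "(x \<ominus> psum ?b k) \<ominus> ?b k = x \<ominus> psum ?b (Suc k)"
    using b x by (simp add: lc_sub_def smult_add add_ac)
  ultimately show ?case by simp
qed

text \<open>The remainder after \<open>k\<close> blocks is invisible to \<open>q k\<close>. Both
  injectivity and openness of the coordinate map rest on this estimate.\<close>

lemma q_le_sum_proj:
  assumes x: "x \<in> C"
  shows "q k x \<le> (\<Sum>i<k. q (Suc i) (proj (block i) x))"
proof -
  let ?s = "psum (\<lambda>i. proj (block i) x) k"
  have s: "?s \<in> C" using proj_closed x by simp
  have "q k x \<le> q k ?s + q k (x \<ominus> ?s)"
    using triangle[of ?s "x \<ominus> ?s" k] x s by simp
  also have "q k (x \<ominus> ?s) = 0" using sub_psum_proj_kern[OF x] by (simp add: kern_def)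
  finally show ?thesis using q_psum_le[of "\<lambda>i. proj (block i) x" k k] proj_in x by simp
qed

lemma proj_block_injective:
  assumes "x \<in> C" "y \<in> C" "\<And>i. proj (block i) x = proj (block i) y"
  shows "x = y"
proof -
  have "q k (x \<ominus> y) \<le> 0" for k
    using q_le_sum_proj[of "x \<ominus> y" k] assms proj_closed by (simp add: proj_sub)
  then have "x \<ominus> y = \<zero>" using assms by (intro q_separating) auto
  then show ?thesis using sub_eq_zero_iff assms by blast
qed

text \<open>The components may grow arbitrarily: for each \<open>q m\<close> the partial sums are
  constant from \<open>m\<close> on, hence Cauchy. Contractivity of the projections then identifies
  the components of the limit.\<close>

lemma proj_block_surjective:
  assumes b: "\<And>i. b i \<in> block i"
  shows "\<exists>x\<in>C. \<forall>i. proj (block i) x = b i"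
proof -
  have bC: "b i \<in> C" for i using b block_closed by blast
  have "\<exists>N. \<forall>k\<ge>N. \<forall>l\<ge>N. q m (psum b k \<ominus> psum b l) < e" if e: "0 < e" for m e
  proof -
    have "q m (psum b k \<ominus> psum b l) < e" if "k \<ge> m" "l \<ge> m" for k l
    proof -
      have "q m (psum b k \<ominus> psum b l) \<le> q m (psum b k \<ominus> psum b m) + q m (psum b l \<ominus> psum b m)"
        using p_sub_triangle[of "psum b k" "psum b m" "psum b l" m]
          p_sub_commute[of "psum b m" "psum b l" m] bC by simp
      also have "\<dots> = 0"
        using psum_sub_psum_kern[OF b \<open>m \<le> k\<close>] psum_sub_psum_kern[OF b \<open>m \<le> l\<close>]
        by (simp add: kern_def)
      finally show ?thesis using e by simp
    qed
    then show ?thesis by blast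
  qed
  then obtain x where x: "x \<in> C"
    and lim: "\<And>m e. 0 < e \<Longrightarrow> \<forall>\<^sub>F k in sequentially. q m (psum b k \<ominus> x) < e"
    using Cauchy_limit[of "psum b"] bC psum_closed by blast
  have "proj (block i) x = b i" for i
  proof -
    have "q m (proj (block i) x \<ominus> b i) \<le> 0 + e" if "0 < e" for m e
    proof -
      have "\<forall>\<^sub>F k in sequentially. q m (psum b k \<ominus> x) < e \<and> i < k"
        using lim[OF that, of m] eventually_gt_at_top[of i] by (rule eventually_conj)
      then obtain k where k: "q m (psum b k \<ominus> x) < e" "i < k"
        using eventually_happens'[OF sequentially_bot] by blast
      have "proj (block i) (psum b k \<ominus> x) = b i \<ominus> proj (block i) x"
        using proj_psum[OF b, of i k] k(2) x bC by (simp add: proj_sub)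
      then have "q m (b i \<ominus> proj (block i) x) \<le> q m (psum b k \<ominus> x)"
        using q_proj_le[of "block i" "psum b k \<ominus> x" m] x bC by simp
      then show ?thesis
        using k(1) p_sub_commute[of "b i" "proj (block i) x" m] proj_closed x bC by simp
    qed
    then have "q m (proj (block i) x \<ominus> b i) \<le> 0" for m by (rule field_le_epsilon)
    then have "proj (block i) x \<ominus> b i = \<zero>"
      using proj_closed x bC by (intro q_separating) auto
    then show ?thesis using sub_eq_zero_iff proj_closed x bC star_ideal_block by blast
  qed
  then show ?thesis using x by blast
qed

section \<open>The blocks as annihilator C*-algebras\<close>

definition summand :: "nat \<Rightarrow> 'a lcstar" where
  "summand n = A\<lparr>lc_carrier := block n, lc_seminorms := {q (Suc n)}\<rparr>"

lemma summand_simps [simp]: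
  "lc_carrier (summand n) = block n" "lc_add (summand n) = lc_add A" "lc_mult (summand n) = lc_mult A"
  "lc_smult (summand n) = lc_smult A" "lc_star (summand n) = lc_star A" "lc_zero (summand n) = \<zero>"
  "lc_seminorms (summand n) = {q (Suc n)}" "lc_sub (summand n) = lc_sub A"
  by (simp_all add: summand_def lc_sub_def fun_eq_iff)

lemma star_alg_seq_summand: "star_alg_seq (summand n) (\<lambda>_. q (Suc n))"
proof unfold_locales
  note D = star_idealD[OF star_ideal_block[of n]]
  show "star_algebra (summand n)"
    unfolding summand_def
    using D star_ideal_block[of n] by (intro star_algebra_subalgebra) (auto simp: star_ideal_def)
  show "c_star_seminorm (summand n) (q (Suc n))"
    using q_c_star[of "Suc n"] D(1) unfolding c_star_seminorm_def by simp
  show "x = lc_zero (summand n)" if "x \<in> lc_carrier (summand n)" "\<And>n'. q (Suc n) x = 0" for x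
  proof -
    have "x \<in> kern (Suc n)" "x \<in> perp (kern (Suc n))"
      using that by (auto simp: block_def kern_def)
    then show ?thesis using star_ideal_Int_perp[OF star_ideal_kern] by simp
  qed
qed auto

text \<open>On a block the norm \<open>q (Suc n)\<close> dominates every \<open>q m\<close>, so a
  Cauchy filter there is Cauchy in \<open>A\<close>. Its limit is projected back to the block;
  contractivity preserves the convergence.\<close>

lemma lc_complete_summand: "lc_complete (summand n)"
  unfolding lc_complete_def summand_simps
proof (intro allI impI, elim conjE)
  fix F
  assume F: "F \<noteq> bot" "\<forall>\<^sub>F x in F. x \<in> block n"
    and Cauchy: "\<forall>p\<in>{q (Suc n)}. \<forall>e>0. \<forall>\<^sub>F (x, y) in F \<times>\<^sub>F F. p (x \<ominus> y) < e"
  note D = star_idealD[OF star_ideal_block[of n]]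
  have both: "\<forall>\<^sub>F z in F \<times>\<^sub>F F. fst z \<in> block n \<and> snd z \<in> block n"
    unfolding eventually_prod_filter using F(2) by (intro exI[of _ "\<lambda>x. x \<in> block n"]) auto
  have "\<forall>\<^sub>F (x, y) in F \<times>\<^sub>F F. q m (x \<ominus> y) < e" if "0 < e" for m e
  proof -
    have "\<forall>\<^sub>F (x, y) in F \<times>\<^sub>F F. q (Suc n) (x \<ominus> y) < e" using Cauchy that by simp
    with both show ?thesis
    proof eventually_elim
      case (elim z)
      then have "fst z \<ominus> snd z \<in> block n" using D(5) by blast
      then show ?case
        using elim(2) q_block_le[of "fst z \<ominus> snd z" n m] by (auto simp: case_prod_unfold)
    qed
  qed
  moreover have FC: "\<forall>\<^sub>F x in F. x \<in> C"
    using F(2) by eventually_elim (rule block_closed)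
  ultimately have "\<exists>a\<in>C. \<forall>p\<in>range q. \<forall>e>0. \<forall>\<^sub>F x in F. p (x \<ominus> a) < e"
    using complete F(1) unfolding lc_complete_def seminorms by blast
  then obtain a where a: "a \<in> C" "\<And>m e. 0 < e \<Longrightarrow> \<forall>\<^sub>F x in F. q m (x \<ominus> a) < e"
    by auto
  have "\<forall>\<^sub>F x in F. q (Suc n) (x \<ominus> proj (block n) a) < e" if "0 < e" for e
    using F(2) a(2)[OF that, of "Suc n"]
  proof eventually_elim
    case (elim x)
    then have "x \<ominus> proj (block n) a = proj (block n) (x \<ominus> a)"
      using a(1) block_closed by (simp add: proj_sub proj_id)
    then show ?case
      using q_proj_le[of "block n" "x \<ominus> a" "Suc n"] elim a(1) block_closed by fastforce
  qed
  then show "\<exists>a\<in>block n. \<forall>p\<in>{q (Suc n)}. \<forall>e>0. \<forall>\<^sub>F x in F. p (x \<ominus> a) < e"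
    using proj_in[OF star_ideal_block a(1)] by auto
qed

lemma c_star_algebra_summand: "c_star_algebra (summand n)"
proof -
  interpret B: star_alg_seq "summand n" "\<lambda>_. q (Suc n)" by (rule star_alg_seq_summand)
  show ?thesis
    unfolding c_star_algebra_def locally_c_star_algebra_def
    using B.star_algebra B.q_c_star B.q_separating B.continuous_map_mult lc_complete_summand[of n]
    by auto
qed

lemma annihilator_summand: "annihilator_algebra (summand n)"
proof -
  interpret B: star_alg_seq "summand n" "\<lambda>_. q (Suc n)" by (rule star_alg_seq_summand)
  note D = star_idealD[OF star_ideal_block[of n]]
  note D' = star_idealD[OF star_ideal_perp[OF star_ideal_block[of n]]]
  let ?P = "proj (block n)"
  have P: "?P x \<in> block n" "?P x \<in> C" if "x \<in> C" for x using that proj_in proj_closed by auto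
  show ?thesis
  proof (rule B.annihilator_algebraI)
    fix J assume J: "closed_left_ideal (summand n) J"
    then have sub: "J \<subseteq> block n" "\<zero> \<in> J" "\<And>x y. x \<in> J \<Longrightarrow> y \<in> J \<Longrightarrow> x \<oplus> y \<in> J"
      "\<And>c x. x \<in> J \<Longrightarrow> c \<odot> x \<in> J" "\<And>a x. a \<in> block n \<Longrightarrow> x \<in> J \<Longrightarrow> a \<otimes> x \<in> J"
      and cl: "B.cl J \<subseteq> J"
      by (auto simp: closed_left_ideal_def lc_subspace_def B.closedin_iff)
    \<comment> \<open>The preimage of \<open>J\<close> under the projection, a closed left ideal of
      \<open>A\<close> containing \<open>perp (block n)\<close>. It has the same right annihilator
      as \<open>J\<close> has in the block, and is everything exactly when \<open>J\<close> is the
      block.\<close>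
    define J' where "J' = {x \<in> C. ?P x \<in> J}"
    have perp_J': "perp (block n) \<subseteq> J'"
      using sub(2) D'(1) proj_perp_eq_zero by (auto simp: J'_def)
    have J_J': "J \<subseteq> J'"
      using sub(1) D(1) proj_id by (auto simp: J'_def)
    have J': "closed_left_ideal A J'"
      unfolding closed_left_ideal_def
    proof (intro conjI ballI)
      have "\<zero> \<in> J'" using sub(2) J_J' by blast
      then show "lc_subspace A J'"
        using sub(3,4) unfolding lc_subspace_def by (auto simp: J'_def proj_add proj_smult)
      show "a \<otimes> x \<in> J'" if "a \<in> C" "x \<in> J'" for a x
        using that sub(5) P by (simp add: J'_def proj_mult)
      have "x \<in> J'" if x: "x \<in> cl J'" for x
      proof -
        have xC: "x \<in> C" using x cl_subset_carrier by auto
        have "?P x \<in> B.cl J"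
        proof (rule B.clI)
          show "?P x \<in> lc_carrier (summand n)" using P xC by simp
          fix e :: real assume "0 < e"
          then obtain y where y: "y \<in> J'" "q (Suc n) (x \<ominus> y) < e" using clE[OF x] by metis
          then have "q (Suc n) (?P x \<ominus> ?P y) < e"
            using q_proj_le[of "block n" "x \<ominus> y" "Suc n"] xC by (simp add: J'_def proj_sub)
          then show "\<exists>y\<in>J. q (Suc n) (lc_sub (summand n) (?P x) y) < e"
            using y(1) by (auto simp: J'_def)
        qed
        then show ?thesis using cl xC by (auto simp: J'_def)
      qed
      moreover have "J' \<subseteq> C" by (auto simp: J'_def)
      ultimately show "closedin (lc_topology A) J'"
        by (simp add: closedin_iff subset_iff)
    qed
    have "a \<in> ran (summand n) J \<longleftrightarrow> a \<in> ran A J'" for a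
    proof
      assume a: "a \<in> ran (summand n) J"
      then have ab: "a \<in> block n" "\<And>s. s \<in> J \<Longrightarrow> s \<otimes> a = \<zero>" by (auto simp: ran_def)
      have aC: "a \<in> C" using ab D by auto
      have "s \<otimes> a = \<zero>" if "s \<in> J'" for s
      proof -
        have s: "s \<in> C" "?P s \<in> J" using that by (auto simp: J'_def)
        have "(s \<ominus> ?P s) \<otimes> a = \<zero>"
          using perpD(2)[OF proj_perp[OF star_ideal_block s(1)] ab(1)] .
        then have "s \<otimes> a = ?P s \<otimes> a"
          using sub_eq_zero_iff[of "s \<otimes> a" "?P s \<otimes> a"] s P(2) aC by (simp add: sub_mult)
        then show ?thesis using ab(2) s by simp
      qed
      then show "a \<in> ran A J'" using aC by (simp add: ran_def)
    next
      assume "a \<in> ran A J'"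
      then have a: "a \<in> C" "\<And>s. s \<in> J' \<Longrightarrow> s \<otimes> a = \<zero>" by (auto simp: ran_def)
      \<comment> \<open>Since \<open>star ?c\<close> lies in \<open>perp (block n)\<close>, it
        annihilates both \<open>a\<close> and \<open>?P a\<close>. Definiteness makes
        \<open>?c\<close> vanish, so \<open>a\<close> belongs to the block.\<close>
      let ?c = "a \<ominus> ?P a"
      have c: "?c \<in> perp (block n)" using proj_perp a(1) by simp
      then have sc: "star ?c \<in> perp (block n)" using D'(8) by blast
      have "star ?c \<otimes> ?c = star ?c \<otimes> a \<ominus> star ?c \<otimes> ?P a"
        using a(1) P by (simp add: mult_sub)
      also have "\<dots> = \<zero>"
        using a(2)[OF subsetD[OF perp_J' sc]] perpD(2)[OF sc P(1)[OF a(1)]] by simp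
      finally have cc: "star ?c \<otimes> ?c = \<zero>" .
      have "?c \<in> C" using a(1) P(2)[OF a(1)] by simp
      then have "?c = \<zero>" by (rule star_mult_eq_zero[OF _ cc])
      then have "a = ?P a" using sub_eq_zero_iff[OF a(1) P(2)[OF a(1)]] by blast
      then have "a \<in> block n" using P(1)[OF a(1)] by metis
      then show "a \<in> ran (summand n) J" using a(2) J_J' by (auto simp: ran_def)
    qed
    then have "ran (summand n) J = ran A J'" by blast
    moreover have "J' = C \<longleftrightarrow> J = block n"
    proof
      assume L: "J' = C"
      have "x \<in> J" if "x \<in> block n" for x
      proof -
        have "x \<in> J'" using L that D(1) by simp
        then show ?thesis using that proj_id by (simp add: J'_def)
      qed
      then show "J = block n" using sub(1) by blast
    qed (use P in \<open>auto simp: J'_def\<close>)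
    moreover have "ran A J' = {\<zero>} \<longleftrightarrow> J' = C"
      using annihilator J' unfolding annihilator_algebra_def by blast
    ultimately show "ran (summand n) J = {lc_zero (summand n)} \<longleftrightarrow> J = lc_carrier (summand n)"
      by simp
  qed
qed

section \<open>The coordinate map as a homeomorphism onto the product\<close>

lemma continuous_map_proj_block:
  "continuous_map (lc_topology A) (lc_topology (summand i)) (proj (block i))"
  unfolding continuous_map_def
proof (intro conjI allI impI)
  interpret B: star_alg_seq "summand i" "\<lambda>_. q (Suc i)" by (rule star_alg_seq_summand)
  show "proj (block i) \<in> topspace (lc_topology A) \<rightarrow> topspace (lc_topology (summand i))"
    using proj_in by simp
  fix U assume U: "openin (lc_topology (summand i)) U"
  show "openin (lc_topology A) {x \<in> topspace (lc_topology A). proj (block i) x \<in> U}"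
    unfolding openin_iff
  proof (intro conjI ballI)
    fix x assume "x \<in> {x \<in> topspace (lc_topology A). proj (block i) x \<in> U}"
    then have x: "x \<in> C" "proj (block i) x \<in> U" by auto
    obtain e where e: "0 < e" "{y \<in> block i. q (Suc i) (y \<ominus> proj (block i) x) < e} \<subseteq> U"
      using U x(2) unfolding B.openin_iff by auto
    have "{y \<in> C. q (Suc i) (y \<ominus> x) < e} \<subseteq> {x \<in> topspace (lc_topology A). proj (block i) x \<in> U}"
    proof clarify
      fix y assume y: "y \<in> C" "q (Suc i) (y \<ominus> x) < e"
      then have "q (Suc i) (proj (block i) y \<ominus> proj (block i) x) < e"
        using q_proj_le[of "block i" "y \<ominus> x" "Suc i"] x(1) by (simp add: proj_sub)
      then show "y \<in> topspace (lc_topology A) \<and> proj (block i) y \<in> U"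
        using e(2) y(1) proj_in[of "block i" y] by auto
    qed
    then show "\<exists>n e. 0 < e \<and> {y \<in> C. q n (y \<ominus> x) < e}
        \<subseteq> {x \<in> topspace (lc_topology A). proj (block i) x \<in> U}"
      using e(1) by blast
  qed auto
qed

lemma image_proj_block: "(\<lambda>x i. proj (block i) x) ` C = (\<Pi>\<^sub>E i\<in>UNIV. block i)"
proof
  show "(\<lambda>x i. proj (block i) x) ` C \<subseteq> (\<Pi>\<^sub>E i\<in>UNIV. block i)" using proj_in by auto
  show "(\<Pi>\<^sub>E i\<in>UNIV. block i) \<subseteq> (\<lambda>x i. proj (block i) x) ` C"
  proof
    fix b assume "b \<in> (\<Pi>\<^sub>E i\<in>UNIV. block i)"
    then have "\<And>i. b i \<in> block i" by auto
    then obtain x where "x \<in> C" "\<forall>i. proj (block i) x = b i" using proj_block_surjective by metis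
    then show "b \<in> (\<lambda>x i. proj (block i) x) ` C" by (intro image_eqI[of _ _ x]) auto
  qed
qed

lemma open_map_proj_block:
  "open_map (lc_topology A) (product_topology (\<lambda>i. lc_topology (summand i)) UNIV) (\<lambda>x i. proj (block i) x)"
  unfolding open_map_def
proof (intro allI impI)
  fix U assume U: "openin (lc_topology A) U"
  let ?f = "\<lambda>x i. proj (block i) x"
  show "openin (product_topology (\<lambda>i. lc_topology (summand i)) UNIV) (?f ` U)"
  proof (subst openin_subopen, intro ballI)
    fix b assume "b \<in> ?f ` U"
    then obtain x where x: "x \<in> U" "b = ?f x" by blast
    have xC: "x \<in> C" using U x(1) by (auto simp: openin_iff)
    obtain k e where e: "0 < e" "{y \<in> C. q k (y \<ominus> x) < e} \<subseteq> U"
      using U x(1) unfolding openin_iff by meson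
    \<comment> \<open>The box \<open>W\<close> restricts only the first \<open>k\<close>
      coordinates, each to radius \<open>d\<close>; by \<open>q_le_sum_proj\<close> these alone keep
      \<open>q k (y - x)\<close> below \<open>e\<close>. Surjectivity supplies a preimage for each
      point of the box.\<close>
    obtain d where d: "0 < d" "real k * d < e"
      using small_multiple[OF e(1), of "real k"] by auto
    define W where "W i = (if i < k then {w \<in> block i. q (Suc i) (w \<ominus> b i) < d} else block i)" for i
    have b: "b i \<in> block i" for i using x(2) xC proj_in by simp
    have openW: "openin (lc_topology (summand i)) (W i)" for i
    proof -
      interpret B: star_alg_seq "summand i" "\<lambda>_. q (Suc i)" by (rule star_alg_seq_summand)
      show ?thesis
        using B.openin_ball[of "b i" d] b openin_topspace[of "lc_topology (summand i)"]
        by (simp add: W_def)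
    qed
    have "finite {i \<in> UNIV. W i \<noteq> topspace (lc_topology (summand i))}"
      by (rule finite_subset[of _ "{..<k}"]) (auto simp: W_def)
    then have "openin (product_topology (\<lambda>i. lc_topology (summand i)) UNIV) (Pi\<^sub>E UNIV W)"
      using openW by (simp add: openin_PiE_gen)
    moreover have "b \<in> Pi\<^sub>E UNIV W"
      using b d(1) block_closed[OF b] by (simp add: W_def PiE_iff)
    moreover have "Pi\<^sub>E UNIV W \<subseteq> ?f ` U"
    proof
      fix w assume w: "w \<in> Pi\<^sub>E UNIV W"
      then have W: "w i \<in> W i" for i by auto
      moreover have "W i \<subseteq> block i" for i by (auto simp: W_def)
      ultimately have "w i \<in> block i" for i by blast
      then obtain y where y: "y \<in> C" "\<And>i. proj (block i) y = w i"
        using proj_block_surjective by metis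
      have "q k (y \<ominus> x) \<le> (\<Sum>i<k. q (Suc i) (proj (block i) (y \<ominus> x)))"
        using q_le_sum_proj y(1) xC by simp
      also have "\<dots> \<le> (\<Sum>i<k. d)"
      proof (rule sum_mono)
        fix i assume "i \<in> {..<k}"
        then show "q (Suc i) (proj (block i) (y \<ominus> x)) \<le> d"
          using W[of i] y x(2) xC by (simp add: proj_sub W_def)
      qed
      also have "\<dots> < e" using d(2) by simp
      finally have "y \<in> U" using e(2) y(1) by blast
      moreover have "w = ?f y" using y(2) by auto
      ultimately show "w \<in> ?f ` U" by blast
    qed
    ultimately show "\<exists>T. openin (product_topology (\<lambda>i. lc_topology (summand i)) UNIV) T \<and> b \<in> T \<and> T \<subseteq> ?f ` U"
      by blast
  qed
qed

theorem top_star_iso_product_summand: "top_star_iso_product A UNIV summand (\<lambda>x i. proj (block i) x)"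
proof -
  have inj: "inj_on (\<lambda>x i. proj (block i) x) C"
    by (rule inj_onI) (metis proj_block_injective)
  have "homeomorphic_map (lc_topology A) (product_topology (\<lambda>i. lc_topology (summand i)) UNIV)
      (\<lambda>x i. proj (block i) x)"
    using open_map_proj_block inj image_proj_block continuous_map_proj_block
    by (intro bijective_open_imp_homeomorphic_map) (auto simp: continuous_map_componentwise_UNIV)
  then show ?thesis
    unfolding top_star_iso_product_def
    using inj image_proj_block by (simp add: proj_add proj_mult proj_smult proj_star restrict_def)
qed

end

subsection \<open>From metrizability to a sequence of seminorms\<close>

text \<open>Maxima commute with squaring of nonnegative numbers, so they respect the C*-identity, as
  sums in general do not.\<close>

lemma c_star_seminorm_max:
  assumes "c_star_seminorm A p" "c_star_seminorm A r"
  shows "c_star_seminorm A (\<lambda>x. max (p x) (r x))"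
  unfolding c_star_seminorm_def
proof (intro conjI ballI allI)
  note P = assms(1)[unfolded c_star_seminorm_def] and R = assms(2)[unfolded c_star_seminorm_def]
  fix x assume x: "x \<in> lc_carrier A"
  show nonneg: "0 \<le> max (p x) (r x)"
    using P x by (simp add: le_max_iff_disj)
  show "max (p (lc_smult A c x)) (r (lc_smult A c x)) = cmod c * max (p x) (r x)" for c
    using P R x by (simp add: max_mult_distrib_left)
  have "0 \<le> p x" "0 \<le> r x" using P R x by auto
  then have "max ((p x)\<^sup>2) ((r x)\<^sup>2) = (max (p x) (r x))\<^sup>2"
    by (simp add: max_def abs_le_square_iff[symmetric])
  then show "max (p (lc_mult A (lc_star A x) x)) (r (lc_mult A (lc_star A x) x)) = (max (p x) (r x))\<^sup>2"
    using P R x by simp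
  fix y assume y: "y \<in> lc_carrier A"
  have "p (lc_add A x y) \<le> p x + p y" "r (lc_add A x y) \<le> r x + r y"
    using P R x y by auto
  then show "max (p (lc_add A x y)) (r (lc_add A x y)) \<le> max (p x) (r x) + max (p y) (r y)"
    by linarith
  have "p x * p y \<le> max (p x) (r x) * max (p y) (r y)"
    using P x y by (intro mult_mono) (auto simp: le_max_iff_disj)
  moreover have "r x * r y \<le> max (p x) (r x) * max (p y) (r y)"
    using P R x y by (intro mult_mono) (auto simp: le_max_iff_disj)
  moreover have "p (lc_mult A x y) \<le> p x * p y" "r (lc_mult A x y) \<le> r x * r y"
    using P R x y by auto
  ultimately show "max (p (lc_mult A x y)) (r (lc_mult A x y)) \<le> max (p x) (r x) * max (p y) (r y)"
    by linarith
qed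

text \<open>The inserted 0 makes the empty family yield the zero seminorm, from which
  \<open>q 0 = 0\<close> arises.\<close>

lemma c_star_seminorm_Max:
  assumes "finite F" "\<And>p. p \<in> F \<Longrightarrow> c_star_seminorm A p"
  shows "c_star_seminorm A (\<lambda>x. Max (insert 0 ((\<lambda>p. p x) ` F)))"
  using assms
proof (induction F rule: finite_induct)
  case empty
  show ?case by (simp add: c_star_seminorm_def)
next
  case (insert p F)
  have "(\<lambda>x. Max (insert 0 ((\<lambda>p. p x) ` insert p F)))
      = (\<lambda>x. max (p x) (Max (insert 0 ((\<lambda>p. p x) ` F))))"
    using insert(1) by (simp add: insert_commute[of 0])
  then show ?case using insert c_star_seminorm_max by force
qed

context star_alg
begin

lemma openin_seminorm_ball:
  assumes seminorms: "\<And>p. p \<in> lc_seminorms A \<Longrightarrow> c_star_seminorm A p"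
    and p: "p \<in> lc_seminorms A"
  shows "openin (lc_topology A) {x \<in> C. p x < e}"
  unfolding openin_lc_topology
proof (intro conjI ballI)
  interpret star_alg_seminorm A p by unfold_locales (rule seminorms[OF p])
  fix x assume x: "x \<in> {x \<in> C. p x < e}"
  have "{y \<in> C. \<forall>r\<in>{p}. r (y \<ominus> x) < e - p x} \<subseteq> {x \<in> C. p x < e}"
  proof clarify
    fix y assume "y \<in> C" "\<forall>r\<in>{p}. r (y \<ominus> x) < e - p x"
    then show "p y < e" using triangle[of x "y \<ominus> x"] x by simp
  qed
  then show "\<exists>F d. finite F \<and> F \<subseteq> lc_seminorms A \<and> 0 < d \<and>
      {y \<in> C. \<forall>r\<in>F. r (y \<ominus> x) < d} \<subseteq> {x \<in> C. p x < e}"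
    using p x by (intro exI[of _ "{p}"] exI[of _ "e - p x"]) auto
qed auto

text \<open>A countable base at zero supplies countably many finite subfamilies of seminorms;
  \<open>q n\<close> is the maximum over the first \<open>n\<close> of them. The last two properties
  compare \<open>q\<close> with the given family quantitatively, so topology and completeness can
  both be transferred.\<close>

lemma metrizable_seminorm_sequence:
  assumes seminorms: "\<And>p. p \<in> lc_seminorms A \<Longrightarrow> c_star_seminorm A p"
    and metrizable: "metrizable_space (lc_topology A)"
  obtains q :: "nat \<Rightarrow> 'a \<Rightarrow> real" where
    "\<And>n. c_star_seminorm A (q n)"
    "\<And>m n x. m \<le> n \<Longrightarrow> q m x \<le> q n x"
    "\<And>x. q 0 x = 0"
    "\<And>n. \<exists>F. finite F \<and> F \<subseteq> lc_seminorms A \<and> (\<forall>x e. 0 < e \<and> (\<forall>p\<in>F. p x < e) \<longrightarrow> q n x < e)"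
    "\<And>p e. p \<in> lc_seminorms A \<Longrightarrow> 0 < e \<Longrightarrow> \<exists>n d. 0 < d \<and> (\<forall>x\<in>C. q n x < d \<longrightarrow> p x < e)"
proof -
  have "first_countable (lc_topology A)"
    using metrizable by (rule metrizable_imp_first_countable)
  then obtain \<B> where \<B>: "countable \<B>" "\<And>V. V \<in> \<B> \<Longrightarrow> openin (lc_topology A) V"
    and base: "\<And>U. openin (lc_topology A) U \<Longrightarrow> \<zero> \<in> U \<Longrightarrow> \<exists>V\<in>\<B>. \<zero> \<in> V \<and> V \<subseteq> U"
    unfolding first_countable_def by (metis topspace_lc_topology zero_closed)
  \<comment> \<open>The countable family may contain sets missing zero; for these the condition is
    vacuous and a dummy choice is made.\<close>
  define Q where "Q V F e \<longleftrightarrow> finite F \<and> F \<subseteq> lc_seminorms A \<and> 0 < e \<and>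
    (\<zero> \<in> V \<longrightarrow> {y \<in> C. \<forall>p\<in>F. p y < e} \<subseteq> V)" for V F and e :: real
  have "\<exists>F e. Q V F e" if V: "V \<in> \<B>" for V
  proof (cases "\<zero> \<in> V")
    case True
    then obtain F e where F: "finite F" "F \<subseteq> lc_seminorms A" "0 < e"
      "{y \<in> C. \<forall>p\<in>F. p (y \<ominus> \<zero>) < e} \<subseteq> V"
      using \<B>(2)[OF V] unfolding openin_lc_topology by (elim conjE) (drule (1) bspec, blast)
    have "{y \<in> C. \<forall>p\<in>F. p y < e} \<subseteq> {y \<in> C. \<forall>p\<in>F. p (y \<ominus> \<zero>) < e}" by auto
    then show ?thesis using F unfolding Q_def by (intro exI[of _ F] exI[of _ e]) auto
  qed (intro exI[of _ "{}"] exI[of _ 1], simp add: Q_def)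
  then obtain F e where FE: "\<And>V. V \<in> \<B> \<Longrightarrow> Q V (F V) (e V)"
    by metis
  then have F: "\<And>V. V \<in> \<B> \<Longrightarrow> finite (F V)" "\<And>V. V \<in> \<B> \<Longrightarrow> F V \<subseteq> lc_seminorms A"
    and e: "\<And>V. V \<in> \<B> \<Longrightarrow> 0 < e V"
    and nbhd: "\<And>V. V \<in> \<B> \<Longrightarrow> \<zero> \<in> V \<Longrightarrow> {y \<in> C. \<forall>p\<in>F V. p y < e V} \<subseteq> V"
    by (simp_all add: Q_def)
  have "openin (lc_topology A) C" using openin_topspace[of "lc_topology A"] by simp
  then have "\<B> \<noteq> {}" using base[of C] by auto
  then have mem: "from_nat_into \<B> k \<in> \<B>" for k by (rule from_nat_into)
  define G where "G n = (\<Union>k<n. F (from_nat_into \<B> k))" for n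
  have G: "finite (G n)" "G n \<subseteq> lc_seminorms A" for n
    using F mem by (auto simp: G_def)
  define q where "q n x = Max (insert 0 ((\<lambda>p. p x) ` G n))" for n and x :: 'a
  show thesis
  proof (rule that[of q])
    show "c_star_seminorm A (q n)" for n
      unfolding q_def using G seminorms by (intro c_star_seminorm_Max) auto
    show "q m x \<le> q n x" if "m \<le> n" for m n x
    proof -
      have "G m \<subseteq> G n" unfolding G_def using that by (intro UN_mono) auto
      then show ?thesis
        unfolding q_def using G(1)[of n] by (intro Max_mono insert_mono image_mono) auto
    qed
    show "q 0 x = 0" for x by (simp add: q_def G_def)
    show "\<exists>F. finite F \<and> F \<subseteq> lc_seminorms A \<and> (\<forall>x e. 0 < e \<and> (\<forall>p\<in>F. p x < e) \<longrightarrow> q n x < e)" for n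
      using G[of n] by (intro exI[of _ "G n"]) (simp add: q_def)
    show "\<exists>n d. 0 < d \<and> (\<forall>x\<in>C. q n x < d \<longrightarrow> p x < r)" if p: "p \<in> lc_seminorms A" and r: "0 < r" for p r
    proof -
      interpret P: star_alg_seminorm A p by unfold_locales (rule seminorms[OF p])
      obtain V where V: "V \<in> \<B>" "\<zero> \<in> V" "V \<subseteq> {x \<in> C. p x < r}"
        using base[OF openin_seminorm_ball[OF seminorms p, of r]] r by auto
      obtain k where k: "V = from_nat_into \<B> k"
        using V(1) \<B>(1) by (metis from_nat_into_surj)
      have "p x < r" if x: "x \<in> C" "q (Suc k) x < e V" for x
      proof -
        have "s x < e V" if "s \<in> F V" for s
        proof -
          have "s x \<le> q (Suc k) x"
            unfolding q_def using that G(1)[of "Suc k"] k by (intro Max_ge) (auto simp: G_def)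
          then show ?thesis using x by simp
        qed
        then show ?thesis using nbhd[OF V(1,2)] V(3) x by blast
      qed
      then show ?thesis using e[OF V(1)] by blast
    qed
  qed
qed

end

theorem theorem3p30:
  fixes A :: "'a lcstar"
  assumes "sigma_c_star_algebra A"
    and "annihilator_algebra A"
  shows "\<exists>(I :: nat set) (B :: nat \<Rightarrow> 'a lcstar) f.
           (\<forall>i\<in>I. c_star_algebra (B i) \<and> annihilator_algebra (B i)) \<and>
           top_star_iso_product A I B f"
proof -
  have A: "star_algebra A" "\<And>p. p \<in> lc_seminorms A \<Longrightarrow> c_star_seminorm A p"
    "\<And>x. x \<in> lc_carrier A \<Longrightarrow> x \<noteq> lc_zero A \<Longrightarrow> \<exists>p\<in>lc_seminorms A. p x \<noteq> 0"
    "lc_complete A" "metrizable_space (lc_topology A)"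
    using assms(1) unfolding sigma_c_star_algebra_def locally_c_star_algebra_def by auto
  interpret star_alg A by unfold_locales (rule A(1))
  obtain q :: "nat \<Rightarrow> 'a \<Rightarrow> real" where q: "\<And>n. c_star_seminorm A (q n)"
    and mono: "\<And>m n x. m \<le> n \<Longrightarrow> q m x \<le> q n x" and q_0: "\<And>x. q 0 x = 0"
    and q_less: "\<And>n. \<exists>F. finite F \<and> F \<subseteq> lc_seminorms A \<and>
      (\<forall>x e. 0 < e \<and> (\<forall>p\<in>F. p x < e) \<longrightarrow> q n x < e)"
    and less_q: "\<And>p e. p \<in> lc_seminorms A \<Longrightarrow> 0 < e \<Longrightarrow>
      \<exists>n d. 0 < d \<and> (\<forall>x\<in>C. q n x < d \<longrightarrow> p x < e)"
    by (rule metrizable_seminorm_sequence[OF _ A(5)]) (erule A(2), rule that)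
  have finite_less_q: "\<exists>n d. 0 < d \<and> (\<forall>x\<in>C. q n x < d \<longrightarrow> (\<forall>p\<in>F. p x < e))"
    if "finite F" "F \<subseteq> lc_seminorms A" "0 < e" for F e
    using that
  proof (induction F rule: finite_induct)
    case empty
    show ?case by (auto intro: exI[of _ 1])
  next
    case (insert p F)
    then obtain n d where n: "0 < d" "\<forall>x\<in>C. q n x < d \<longrightarrow> (\<forall>p\<in>F. p x < e)" by auto
    obtain m c where m: "0 < c" "\<forall>x\<in>C. q m x < c \<longrightarrow> p x < e"
      using less_q[of p e] insert by auto
    have "q n x < d \<and> q m x < c" if "q (max m n) x < min c d" for x
      using that mono[of n "max m n" x] mono[of m "max m n" x] by auto
    then show ?case
      using n m by (intro exI[of _ "max m n"] exI[of _ "min c d"]) auto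
  qed
  \<comment> \<open>The same algebra with the seminorm family exchanged. Since the topology is
    unchanged, an isomorphism for \<open>A'\<close> is one for \<open>A\<close>.\<close>
  define A' where "A' = A\<lparr>lc_seminorms := range q\<rparr>"
  have A'_simps [simp]: "lc_carrier A' = C" "lc_add A' = lc_add A" "lc_mult A' = lc_mult A"
    "lc_smult A' = lc_smult A" "lc_star A' = lc_star A" "lc_zero A' = \<zero>"
    "lc_seminorms A' = range q" "lc_sub A' = lc_sub A"
    by (simp_all add: A'_def lc_sub_def fun_eq_iff)
  interpret A': star_alg_seq A' q
  proof unfold_locales
    show "star_algebra A'" using A(1) unfolding star_algebra_def by simp
    show "c_star_seminorm A' (q n)" for n using q[of n] unfolding c_star_seminorm_def by simp
    show "x = lc_zero A'" if x: "x \<in> lc_carrier A'" and 0: "\<And>n. q n x = 0" for x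
    proof (rule ccontr)
      assume "x \<noteq> lc_zero A'"
      then obtain p where p: "p \<in> lc_seminorms A" "p x \<noteq> 0" using A(3)[of x] x by auto
      interpret P: star_alg_seminorm A p by unfold_locales (rule A(2)[OF p(1)])
      have "p x \<noteq> 0" "x \<in> C" using p x by auto
      then have "0 < p x" using P.nonneg[of x] by linarith
      then show False using less_q[OF p(1), of "p x"] 0 \<open>x \<in> C\<close> by force
    qed
  qed (use mono in auto)
  have topology: "lc_topology A' = lc_topology A"
    unfolding topology_eq
  proof
    fix U
    have "(\<exists>n e. 0 < e \<and> {y \<in> C. q n (y \<ominus> x) < e} \<subseteq> U) \<longleftrightarrow>
      (\<exists>F e. finite F \<and> F \<subseteq> lc_seminorms A \<and> 0 < e \<and> {y \<in> C. \<forall>p\<in>F. p (y \<ominus> x) < e} \<subseteq> U)"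
      (is "?L \<longleftrightarrow> ?R") if "U \<subseteq> C" "x \<in> U" for x
    proof
      assume ?L
      then obtain n e where n: "0 < e" "{y \<in> C. q n (y \<ominus> x) < e} \<subseteq> U" by (elim exE conjE)
      obtain F where F: "finite F" "F \<subseteq> lc_seminorms A"
        "\<forall>x e. 0 < e \<and> (\<forall>p\<in>F. p x < e) \<longrightarrow> q n x < e"
        using q_less[of n] by (elim exE conjE)
      have "{y \<in> C. \<forall>p\<in>F. p (y \<ominus> x) < e} \<subseteq> {y \<in> C. q n (y \<ominus> x) < e}"
        using F(3) n(1) by auto
      then have "{y \<in> C. \<forall>p\<in>F. p (y \<ominus> x) < e} \<subseteq> U"
        using n(2) by (rule order_trans)
      with F(1,2) n(1) show ?R by (intro exI[of _ F] exI[of _ e] conjI)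
    next
      assume ?R
      then obtain F e where F: "finite F" "F \<subseteq> lc_seminorms A" "0 < e"
        "{y \<in> C. \<forall>p\<in>F. p (y \<ominus> x) < e} \<subseteq> U" by (elim exE conjE)
      obtain n d where n: "0 < d" "\<forall>x\<in>C. q n x < d \<longrightarrow> (\<forall>p\<in>F. p x < e)"
        using finite_less_q[OF F(1-3)] by (elim exE conjE)
      have "x \<in> C" using that by auto
      then have "{y \<in> C. q n (y \<ominus> x) < d} \<subseteq> {y \<in> C. \<forall>p\<in>F. p (y \<ominus> x) < e}"
        using n(2) by auto
      then have "{y \<in> C. q n (y \<ominus> x) < d} \<subseteq> U"
        using F(4) by (rule order_trans)
      with n(1) show ?L by (intro exI[of _ n] exI[of _ d] conjI)
    qed
    then show "openin (lc_topology A') U \<longleftrightarrow> openin (lc_topology A) U"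
      unfolding A'.openin_iff openin_lc_topology[of A] A'_simps
      by (intro conj_cong ball_cong refl)
  qed
  \<comment> \<open>The seminorms enter this notion only through the topology, so unfolding and
    rewriting make hypothesis and goal coincide.\<close>
  have annihilator: "annihilator_algebra A'"
    using assms(2)
    unfolding annihilator_algebra_def closed_left_ideal_def closed_right_ideal_def lc_subspace_def
      ran_def lan_def topology A'_simps .
  have complete: "lc_complete A'"
    unfolding lc_complete_def A'_simps
  proof (intro allI impI, elim conjE)
    fix F
    assume F: "F \<noteq> bot" "\<forall>\<^sub>F x in F. x \<in> C"
      and Cauchy: "\<forall>p\<in>range q. \<forall>e>0. \<forall>\<^sub>F (x, y) in F \<times>\<^sub>F F. p (x \<ominus> y) < e"
    have both: "\<forall>\<^sub>F z in F \<times>\<^sub>F F. fst z \<in> C \<and> snd z \<in> C"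
      unfolding eventually_prod_filter using F(2) by (intro exI[of _ "\<lambda>x. x \<in> C"]) auto
    have "\<forall>\<^sub>F (x, y) in F \<times>\<^sub>F F. p (x \<ominus> y) < e" if "p \<in> lc_seminorms A" "0 < e" for p e
    proof -
      obtain n d where n: "0 < d" "\<forall>x\<in>C. q n x < d \<longrightarrow> p x < e" using less_q \<open>p \<in> _\<close> \<open>0 < e\<close> by blast
      then have "\<forall>\<^sub>F (x, y) in F \<times>\<^sub>F F. q n (x \<ominus> y) < d" using Cauchy by simp
      with both show ?thesis
        by eventually_elim (use n(2) in auto)
    qed
    then have "\<exists>a\<in>C. \<forall>p\<in>lc_seminorms A. \<forall>e>0. \<forall>\<^sub>F x in F. p (x \<ominus> a) < e"
      using A(4) F unfolding lc_complete_def by blast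
    then obtain a where a: "a \<in> C"
      and lim: "\<And>p e. p \<in> lc_seminorms A \<Longrightarrow> 0 < e \<Longrightarrow> \<forall>\<^sub>F x in F. p (x \<ominus> a) < e"
      by blast
    have "\<forall>\<^sub>F x in F. q n (x \<ominus> a) < e" if "0 < e" for n e
    proof -
      obtain G where G: "finite G" "G \<subseteq> lc_seminorms A"
        "\<forall>x e. 0 < e \<and> (\<forall>p\<in>G. p x < e) \<longrightarrow> q n x < e"
        using q_less[of n] by (elim exE conjE)
      have "\<forall>\<^sub>F x in F. \<forall>p\<in>G. p (x \<ominus> a) < e"
        using G(2) lim that by (intro eventually_ball_finite G(1)) auto
      then show ?thesis by eventually_elim (use G(3) that in simp)
    qed
    then show "\<exists>a\<in>C. \<forall>p\<in>range q. \<forall>e>0. \<forall>\<^sub>F x in F. p (x \<ominus> a) < e" using a by blast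
  qed
  interpret A': annihilator_star_alg0 A' q
    by unfold_locales (use annihilator complete q_0 in auto)
  \<comment> \<open>All natural numbers serve as indices; where two consecutive kernels agree, the
    factor is the zero algebra.\<close>
  have "top_star_iso_product A UNIV A'.summand (\<lambda>x i. A'.proj (A'.block i) x)"
    using A'.top_star_iso_product_summand
    unfolding top_star_iso_product_def topology A'_simps .
  then show ?thesis
    using A'.c_star_algebra_summand A'.annihilator_summand by blast
qed

end
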